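(* For all integers $n\geq 2$ and $m\geq 2$, the normalized Laplacian spectral gap of the generalized pancake graph $P(m,n)$ satisfies \[ \frac{2}{nm^2}\leq \gamma(P(m,n))\leq \frac{\pi^2(n+1)}{nm^2}. \]
   Context: Let $[n]=\{1,\dots,n\}$. $S(m,n)=\mathbb{Z}_m\wr S_n=(\mathbb{Z}_m)^n\rtimes S_n$ is the group of colored permutations, where $S_n$ acts on $(\mathbb{Z}_m)^n$ by $(\sigma\cdot a)_j=a_{\sigma^{-1}(j)}$, so that $(a,\sigma)(b,\tau)=(a+\sigma\cdot b,\sigma\tau)$. For $1\le i\le n$, $r_i\in S_n$ is the permutation with $r_i(j)=i+1-j$ for $j\le i$ and $r_i(j)=j$ for $j>i$ (so $r_1=e$). For $\varepsilon\in\{+,-\}$, let $c_i^{\varepsilon}\in(\mathbb{Z}_m)^n$ be the vector whose first $i$ components are all $\varepsilon 1$ (i.e. $+1$ or $-1$) and whose other components are $0$, and let $r_i^{\varepsilon}=(c_i^{\varepsilon},r_i)\in S(m,n)$. For $m\ge2$ the set of generalized prefix reversals is $R(m,n)=\{r_i^{\varepsilon}:1\le i\le n,\ \varepsilon\in\{+,-\}\}$; it is closed under inverses, and has $n$ elements if $m=2$ (since then $r_i^+=r_i^-$) and $2n$ elements if $m\ge3$. The generalized pancake graph $P(m,n)$ is the Cayley graph of $S(m,n)$ with respect to $R(m,n)$: its vertex set is $S(m,n)$ and its edges join $x$ to $s x$ for $s\in R(m,n)$. It is a connected $d$-regular graph with $d=|R(m,n)|$. For a finite $d$-regular graph $\mathcal{G}$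 with adjacency matrix $A_{\mathcal G}$, $\gamma(\mathcal G)$ denotes the second smallest eigenvalue (with multiplicity) of the normalized Laplacian $I-\frac1d A_{\mathcal G}$, i.e. $\gamma(\mathcal G)=1-\frac1d\lambda_2(A_{\mathcal G})$, where $\lambda_2$ is the second largest eigenvalue counted with multiplicity. *)

theory Defs
  imports
    Complex_Main
    "HOL-Algebra.Elementary_Groups"
    "HOL-Algebra.Product_Groups"
    "HOL-Algebra.Sym_Groups"
    "Graph_Theory.Pair_Digraph"
    "Jordan_Normal_Form.Char_Poly"
begin

section \<open>Colored permutations\<close>

text \<open>
  Color vectors are functions on \<open>{1..n}\<close> that are \<open>undefined\<close> elsewhere (the convention of
  \<^const>\<open>product_group\<close>), with entries in \<open>{0..<int m}\<close>; permutations are the functions on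
  \<^typ>\<open>nat\<close> that are the identity outside \<open>{1..n}\<close>.
\<close>

type_synonym colored_perm = "(nat \<Rightarrow> int) \<times> (nat \<Rightarrow> nat)"

definition color_group :: "nat \<Rightarrow> nat \<Rightarrow> (nat \<Rightarrow> int) monoid" where
  "color_group m n = product_group {1..n} (\<lambda>_. integer_mod_group m)"

definition perm_act :: "nat \<Rightarrow> (nat \<Rightarrow> nat) \<Rightarrow> (nat \<Rightarrow> int) \<Rightarrow> (nat \<Rightarrow> int)" where
  "perm_act n \<sigma> a = (\<lambda>j\<in>{1..n}. a (inv' \<sigma> j))"

definition colored_perm_group :: "nat \<Rightarrow> nat \<Rightarrow> colored_perm monoid" where
  "colored_perm_group m n =
     \<lparr> carrier = carrier (color_group m n) \<times> carrier (sym_group n),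
       monoid.mult = (\<lambda>(a, \<sigma>) (b, \<tau>).
         (a \<otimes>\<^bsub>color_group m n\<^esub> perm_act n \<sigma> b, \<sigma> \<otimes>\<^bsub>sym_group n\<^esub> \<tau>)),
       one = (\<one>\<^bsub>color_group m n\<^esub>, \<one>\<^bsub>sym_group n\<^esub>) \<rparr>"

definition prefix_rev :: "nat \<Rightarrow> nat \<Rightarrow> nat" where
  "prefix_rev i j = (if j \<in> {1..i} then i + 1 - j else j)"

definition prefix_color :: "nat \<Rightarrow> nat \<Rightarrow> int \<Rightarrow> nat \<Rightarrow> (nat \<Rightarrow> int)" where
  "prefix_color m n \<epsilon> i = (\<lambda>j\<in>{1..n}. if j \<le> i then \<epsilon> mod int m else 0)"

definition gen_prefix_reversals :: "nat \<Rightarrow> nat \<Rightarrow> colored_perm set" where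
  "gen_prefix_reversals m n =
     {(prefix_color m n \<epsilon> i, prefix_rev i) | \<epsilon> i. \<epsilon> \<in> {1, -1} \<and> i \<in> {1..n}}"

section \<open>Cayley graphs\<close>

text \<open>
  An undirected edge is represented by its two opposite arcs; for a set of generators closed
  under inverses the arcs below are symmetric.
\<close>

definition cayley_graph :: "('a, 'b) monoid_scheme \<Rightarrow> 'a set \<Rightarrow> 'a pair_pre_digraph" where
  "cayley_graph G S =
     \<lparr> pverts = carrier G, parcs = {(x, s \<otimes>\<^bsub>G\<^esub> x) | x s. x \<in> carrier G \<and> s \<in> S} \<rparr>"

definition pancake_graph :: "nat \<Rightarrow> nat \<Rightarrow> colored_perm pair_pre_digraph" where
  "pancake_graph m n = cayley_graph (colored_perm_group m n) (gen_prefix_reversals m n)"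

section \<open>Spectral gap of a finite regular graph\<close>

definition adjacency_matrix :: "'a pair_pre_digraph \<Rightarrow> 'a list \<Rightarrow> real mat" where
  "adjacency_matrix G vs =
     mat (length vs) (length vs) (\<lambda>(i, j). if (vs ! i, vs ! j) \<in> parcs G then 1 else 0)"

definition regular_degree :: "'a pair_pre_digraph \<Rightarrow> nat" where
  "regular_degree G = (THE d. \<forall>v \<in> pverts G. out_degree (with_proj G) v = d)"

definition normalized_laplacian :: "'a pair_pre_digraph \<Rightarrow> 'a list \<Rightarrow> real mat" where
  "normalized_laplacian G vs =
     1\<^sub>m (length vs) - (1 / real (regular_degree G)) \<cdot>\<^sub>m adjacency_matrix G vs"

text \<open>
  The vertices are enumerated in some order; the characteristic polynomial does not depend on
  it. Its real roots, listed in increasing order and with multiplicity, are all the eigenvalues,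
  since the Laplacian of an undirected graph is symmetric.
\<close>

definition laplacian_spectrum :: "'a pair_pre_digraph \<Rightarrow> real list" where
  "laplacian_spectrum G =
     sorted_list_of_multiset (proots (char_poly (normalized_laplacian G
       (SOME vs. distinct vs \<and> set vs = pverts G))))"

text \<open>List positions start at 0, so this is the second smallest eigenvalue.\<close>

definition spectral_gap :: "'a pair_pre_digraph \<Rightarrow> real" where
  "spectral_gap G = laplacian_spectrum G ! 1"

end

theory Submission
  imports Defs
begin

text \<open>
  Let \<open>L\<^sub>i f(x) = f(x) - (f(r\<^sub>i\<^sup>+ x) + f(r\<^sub>i\<^sup>- x)) / 2\<close>. The normalized Laplacian of the
  pancake graph is \<open>(L\<^sub>1 + \<dots> + L\<^sub>n) / n\<close>; this also covers \<open>m = 2\<close>, where the two flips of a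
  prefix coincide. By the spectral theorem, the gap is the least Rayleigh quotient of this operator
  on functions with sum zero. So the lower bound says that \<open>L\<^sub>1 + \<dots> + L\<^sub>n\<close> is at least \<open>2 / m\<^sup>2\<close>
  there, and any nonzero function with sum zero gives an upper bound.

  A group element \<open>(a, \<sigma>)\<close> is read as a stack of pancakes: position \<open>j\<close> holds the pancake with
  label \<open>\<sigma>\<^sup>-\<^sup>1(j)\<close> and color \<open>a\<^sub>j\<close>. A generator reverses the first \<open>i\<close> pancakes and shifts their
  colors by \<open>1\<close> or by \<open>-1\<close>.

  Lower bound. The claim (\<open>block_gap\<close>) is proved for \<open>L\<^sub>1 + \<dots> + L\<^sub>p\<close> by induction on \<open>p\<close>, on
  the functions that sum to zero over every block, a block being the set of stacks that agree
  in all positions below the top \<open>p\<close>. Let \<open>q\<close> be such an eigenfunction with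
  eigenvalue \<open>\<mu> < 2 / m\<^sup>2\<close>. In a block, fix a label \<open>k\<close> occurring in the top \<open>p\<close> positions, and let \<open>G j c\<close> be the sum of \<open>q\<close> over the
  stacks in which pancake \<open>k\<close> has position \<open>j\<close> and color \<open>c\<close>; then \<open>G\<close> has sum zero. Each flip moves pancake \<open>k\<close> in a
  way that depends on its position and color only, so \<open>G\<close> satisfies the eigenvalue equation, with
  the same \<open>\<mu>\<close>, for one pancake walking on \<open>{1..p} \<times> \<int>\<^sub>m\<close>. That walk has gap at least \<open>2 / m\<^sup>2\<close>
  (\<open>quotient_energy_bound\<close>), hence \<open>G = 0\<close>. For \<open>j = p\<close> this says that \<open>q\<close> sums to zero over the
  smaller blocks, on which the \<open>p\<close>-th position is fixed too. The induction hypothesis and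
  \<open>L\<^sub>p \<ge> 0\<close> then give \<open>\<mu> \<ge> 2 / m\<^sup>2\<close> unless \<open>q = 0\<close>.

  Gap of the single pancake. A function on \<open>{1..p} \<times> \<int>\<^sub>m\<close> is the sum of a function \<open>g\<close> of the
  position and a function \<open>h\<close> whose sum over the colors vanishes at each position, and the energy
  splits accordingly. For \<open>g\<close> the moves between position \<open>1\<close> and the other positions suffice. For
  \<open>h\<close> the flip of the first \<open>2 j - 1\<close> pancakes leaves position \<open>j\<close> in place and rotates its color,
  so the Poincare inequality of the \<open>m\<close>-cycle controls the top half of the positions, and
  the flip of all \<open>p\<close> pancakes carries this over to the bottom half.

  Upper bound. The test function is \<open>cos (2 \<pi> c / m)\<close>, where \<open>c\<close> is the color of the pancake with
  label \<open>1\<close>. A flip of length \<open>i\<close> changes it only if that pancake is among the first \<open>i\<close>, and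
  averaged over the position this happens for a fraction \<open>(n + 1) / (2 n)\<close> of the flips.
\<close>

section \<open>Orthogonal diagonalization of real symmetric matrices\<close>

text \<open>
  A complex eigenvalue \<open>z\<close> exists by the fundamental theorem of algebra. For an eigenvector \<open>u\<close> the
  number \<open>u\<^sup>* A u = z |u|\<^sup>2\<close> equals its own conjugate because \<open>A\<close> is real and symmetric, so \<open>z\<close> is
  real and is a root of the real characteristic polynomial.
\<close>

lemma symmetric_mat_has_eigenvector:
  fixes A :: "real mat"
  assumes A: "A \<in> carrier_mat N N" and "N > 0"
    and sym: "\<And>i j. i < N \<Longrightarrow> j < N \<Longrightarrow> A $$ (i, j) = A $$ (j, i)"
  obtains e v where "v \<in> carrier_vec N" "v \<noteq> 0\<^sub>v N" "A *\<^sub>v v = e \<cdot>\<^sub>v v"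
proof -
  let ?C = "map_mat complex_of_real A"
  have C: "?C \<in> carrier_mat N N" using A by simp
  have cp: "char_poly ?C = map_poly complex_of_real (char_poly A)"
    using of_real_hom.char_poly_hom[OF A] by simp
  have "degree (char_poly ?C) = N" using degree_monic_char_poly[OF C] by simp
  then have "\<not> constant (poly (char_poly ?C))"
    using \<open>N > 0\<close> by (simp add: constant_degree)
  then obtain z where z: "poly (char_poly ?C) z = 0"
    using fundamental_theorem_of_algebra by blast
  then have "eigenvalue ?C z" using eigenvalue_root_char_poly[OF C] by simp
  then obtain u where u: "u \<in> carrier_vec N" "u \<noteq> 0\<^sub>v N" "?C *\<^sub>v u = z \<cdot>\<^sub>v u"
    unfolding eigenvalue_def eigenvector_def using C by auto
  have Cu: "(\<Sum>j<N. complex_of_real (A $$ (i, j)) * u $ j) = z * u $ i" if "i < N" for i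
  proof -
    have "(?C *\<^sub>v u) $ i = (\<Sum>j<N. complex_of_real (A $$ (i, j)) * u $ j)"
      using that A u(1) by (simp add: scalar_prod_def lessThan_atLeast0)
    then show ?thesis using u(1,3) that by simp
  qed
  define S where "S = (\<Sum>i<N. (cmod (u $ i))\<^sup>2)"
  define T where "T = (\<Sum>i<N. \<Sum>j<N. complex_of_real (A $$ (i, j)) * (cnj (u $ i) * u $ j))"
  have "T = (\<Sum>i<N. cnj (u $ i) * (\<Sum>j<N. complex_of_real (A $$ (i, j)) * u $ j))"
    unfolding T_def by (simp add: sum_distrib_left mult_ac)
  also have "\<dots> = (\<Sum>i<N. z * complex_of_real ((cmod (u $ i))\<^sup>2))"
  proof (intro sum.cong refl)
    fix i assume "i \<in> {..<N}"
    then have "cnj (u $ i) * (\<Sum>j<N. complex_of_real (A $$ (i, j)) * u $ j) = z * (u $ i * cnj (u $ i))"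
      using Cu by (simp only: lessThan_iff mult_ac)
    then show "cnj (u $ i) * (\<Sum>j<N. complex_of_real (A $$ (i, j)) * u $ j) =
        z * complex_of_real ((cmod (u $ i))\<^sup>2)"
      by (simp only: complex_norm_square)
  qed
  finally have T1: "T = z * complex_of_real S" by (simp add: S_def sum_distrib_left)
  have "cnj T = (\<Sum>i<N. \<Sum>j<N. complex_of_real (A $$ (j, i)) * (u $ i * cnj (u $ j)))"
    unfolding T_def by (simp add: sym)
  also have "\<dots> = T" unfolding T_def by (subst sum.swap) (simp add: mult_ac)
  finally have T2: "cnj T = T" .
  have "S > 0"
  proof -
    obtain i where "i < N" "u $ i \<noteq> 0" using u(1,2) by (metis carrier_vecD eq_vecI index_zero_vec)
    then show ?thesis unfolding S_def by (intro sum_pos2[of _ i]) auto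
  qed
  then have "cnj z = z" using T1 T2 by simp
  then obtain e where e: "z = complex_of_real e" by (metis Reals_cnj_iff Reals_cases)
  have "poly (char_poly A) e = 0"
    using z unfolding cp e by (metis of_real_hom.poly_map_poly of_real_eq_0_iff)
  then have "eigenvalue A e" using eigenvalue_root_char_poly[OF A] by simp
  then show ?thesis using that A unfolding eigenvalue_def eigenvector_def by auto
qed

text \<open>
  The reflection in the hyperplane orthogonal to \<open>w = v - e\<^sub>0\<close> exchanges \<open>e\<^sub>0\<close> and \<open>v\<close>. It serves
  to complete a unit eigenvector to an orthonormal basis. If \<open>v = e\<^sub>0\<close>, the convention
  \<open>x / 0 = 0\<close> turns the formula below into the identity matrix, as it should.
\<close>

lemma householder_reflection:
  fixes v :: "real vec"
  assumes v: "v \<in> carrier_vec N" and N: "N > 0" and unit: "(\<Sum>i<N. (v $ i)\<^sup>2) = 1"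
  obtains H where "H \<in> carrier_mat N N" "H\<^sup>T = H" "H * H = 1\<^sub>m N" "col H 0 = v"
proof -
  define w where "w i = v $ i - of_bool (i = 0)" for i
  define W where "W = (\<Sum>i<N. (w i)\<^sup>2)"
  define H where "H = mat N N (\<lambda>(i, j). of_bool (i = j) - 2 / W * (w i * w j))"
  have e0: "(\<Sum>i<N. of_bool (i = 0) * f i) = f 0" for f :: "nat \<Rightarrow> real"
    using N by (simp add: of_bool_def if_distrib[of "\<lambda>x. x * _"] sum.delta cong: if_cong)
  have "W = (\<Sum>i<N. (v $ i)\<^sup>2 - of_bool (i = 0) * (2 * v $ i) + of_bool (i = 0) * 1)"
    unfolding W_def w_def by (intro sum.cong refl) (auto simp: power2_eq_square algebra_simps)
  also have "\<dots> = - 2 * w 0"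
    using unit unfolding sum.distrib sum_subtractf e0 by (simp add: w_def)
  finally have Ww: "W = - 2 * w 0" .
  have "(H * H) $$ (i, j) = of_bool (i = j)" if "i < N" "j < N" for i j
  proof -
    have "(H * H) $$ (i, j) = (\<Sum>k<N. (of_bool (i = k) - 2 / W * (w i * w k)) *
        (of_bool (k = j) - 2 / W * (w k * w j)))"
      using that by (simp add: H_def scalar_prod_def lessThan_atLeast0)
    also have "\<dots> = (\<Sum>k<N. (if k = i then of_bool (k = j) - 2 / W * (w k * w j) else 0)
        - (if k = j then 2 / W * (w i * w k) else 0) + (2 / W)\<^sup>2 * (w i * w j) * (w k)\<^sup>2)"
      by (intro sum.cong refl) (simp add: of_bool_def algebra_simps power2_eq_square)
    also have "\<dots> = of_bool (i = j) - 2 / W * (w i * w j) - 2 / W * (w i * w j)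
        + (2 / W)\<^sup>2 * (w i * w j) * W"
      using that by (simp add: sum.distrib sum_subtractf sum.delta sum_distrib_left[symmetric] W_def)
    also have "\<dots> = of_bool (i = j)"
      by (cases "W = 0") (simp_all add: power2_eq_square field_simps)
    finally show ?thesis .
  qed
  then have HH: "H * H = 1\<^sub>m N" by (intro eq_matI) (auto simp: H_def of_bool_def)
  have "col H 0 = v"
  proof (intro eq_vecI)
    fix i assume "i < dim_vec v"
    then have i: "i < N" using v by simp
    \<comment> \<open>Column \<open>0\<close> is \<open>e\<^sub>0 - (2 w\<^sub>0 / W) w\<close>, and \<open>W = - 2 w\<^sub>0\<close> makes this \<open>e\<^sub>0 + w = v\<close>.\<close>
    have "2 / W * (w i * w 0) = - w i"
    proof (cases "W = 0")
      case True
      then have "w i = 0" using i unfolding W_def by (subst (asm) sum_nonneg_eq_0_iff) auto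
      then show ?thesis by simp
    qed (simp add: Ww)
    then show "col H 0 $ i = v $ i" using i N by (simp add: H_def w_def)
  qed (use v in \<open>simp add: H_def\<close>)
  moreover have "H\<^sup>T = H" by (intro eq_matI) (auto simp: H_def of_bool_def)
  ultimately show ?thesis using that[of H] HH by (simp add: H_def)
qed

text \<open>
  Deflation: conjugating by the reflection that sends \<open>e\<^sub>0\<close> to a unit eigenvector splits off a
  \<open>1 \<times> 1\<close> block, and symmetry makes the rest of the first row vanish as well.
\<close>

lemma symmetric_mat_orthogonally_diagonalizable:
  fixes A :: "real mat"
  assumes "A \<in> carrier_mat N N"
    and "A\<^sup>T = A"
  shows "\<exists>Q D. Q \<in> carrier_mat N N \<and> D \<in> carrier_mat N N \<and> diagonal_mat D \<and>
    Q\<^sup>T * Q = 1\<^sub>m N \<and> A * Q = Q * D"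
  using assms
proof (induction N arbitrary: A)
  case 0
  then show ?case
    by (intro exI[of _ "1\<^sub>m 0"]) (auto simp: diagonal_mat_def intro!: eq_matI)
next
  case (Suc n)
  note A = Suc.prems(1)
  have sym: "A $$ (i, j) = A $$ (j, i)" if "i < Suc n" "j < Suc n" for i j
    by (metis A Suc.prems(2) carrier_matD index_transpose_mat(1) that)
  obtain e u where u: "u \<in> carrier_vec (Suc n)" "u \<noteq> 0\<^sub>v (Suc n)" "A *\<^sub>v u = e \<cdot>\<^sub>v u"
    using symmetric_mat_has_eigenvector[OF A _ sym] by blast
  define r where "r = sqrt (\<Sum>i<Suc n. (u $ i)\<^sup>2)"
  obtain i where i: "i < Suc n" "u $ i \<noteq> 0"
    using u(1,2) by (metis carrier_vecD eq_vecI index_zero_vec)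
  then have r: "r > 0" unfolding r_def by (intro real_sqrt_gt_zero sum_pos2[of _ i]) auto
  define v where "v = (1 / r) \<cdot>\<^sub>v u"
  have v: "v \<in> carrier_vec (Suc n)" using u(1) by (simp add: v_def)
  have Av: "A *\<^sub>v v = e \<cdot>\<^sub>v v"
    using A u by (simp add: v_def mult_mat_vec smult_smult_assoc mult.commute)
  have "(\<Sum>i<Suc n. (v $ i)\<^sup>2) = (\<Sum>i<Suc n. (u $ i)\<^sup>2) / r\<^sup>2"
    unfolding sum_divide_distrib using u(1) by (intro sum.cong refl) (simp add: v_def power_divide)
  also have "\<dots> = 1" using r unfolding r_def by (simp add: sum_nonneg)
  finally have unit: "(\<Sum>i<Suc n. (v $ i)\<^sup>2) = 1" .
  obtain H where H: "H \<in> carrier_mat (Suc n) (Suc n)" "H\<^sup>T = H" "H * H = 1\<^sub>m (Suc n)" "col H 0 = v"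
    using householder_reflection[OF v _ unit] by blast
  define B where "B = H * (A * H)"
  have B: "B \<in> carrier_mat (Suc n) (Suc n)" using H A by (simp add: B_def)
  have "B\<^sup>T = B"
    unfolding B_def using H A Suc.prems(2)
    by (simp add: transpose_mult[of _ "Suc n" "Suc n" _ "Suc n"] assoc_mult_mat[of _ "Suc n" "Suc n" _ "Suc n" _ "Suc n"])
  then have Bsym: "B $$ (i, j) = B $$ (j, i)" if "i < Suc n" "j < Suc n" for i j
    by (metis B carrier_matD index_transpose_mat(1) that)
  have "col B 0 = H *\<^sub>v (A *\<^sub>v v)"
    using col_mult2[OF H(1) mult_carrier_mat[OF A H(1)], of 0] col_mult2[OF A H(1), of 0] H(4)
    by (simp add: B_def)
  also have "\<dots> = e \<cdot>\<^sub>v (H *\<^sub>v col H 0)" using H v by (simp add: Av mult_mat_vec)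
  also have "H *\<^sub>v col H 0 = unit_vec (Suc n) 0"
    using col_mult2[OF H(1) H(1), of 0] H(3) by simp
  finally have B0: "B $$ (i, 0) = (if i = 0 then e else 0)" if "i < Suc n" for i
    using that B by (metis (no_types, lifting) carrier_matD(1,2) index_col index_smult_vec(1) index_unit_vec(1,3)
        mult.right_neutral mult_zero_right zero_less_Suc)
  define A' where "A' = mat n n (\<lambda>(i, j). B $$ (Suc i, Suc j))"
  have A': "A' \<in> carrier_mat n n" "A'\<^sup>T = A'"
    by (auto simp: A'_def Bsym intro!: eq_matI)
  obtain Q' D' where IH: "Q' \<in> carrier_mat n n" "D' \<in> carrier_mat n n" "diagonal_mat D'"
    "Q'\<^sup>T * Q' = 1\<^sub>m n" "A' * Q' = Q' * D'"
    using Suc.IH[OF A'] by blast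
  let ?E = "mat 1 1 (\<lambda>_. e)"
  have Bblock: "B = four_block_mat ?E (0\<^sub>m 1 n) (0\<^sub>m n 1) A'"
  proof (rule eq_matI)
    fix i j assume "i < dim_row (four_block_mat ?E (0\<^sub>m 1 n) (0\<^sub>m n 1) A')"
      "j < dim_col (four_block_mat ?E (0\<^sub>m 1 n) (0\<^sub>m n 1) A')"
    then have ij: "i < Suc n" "j < Suc n" by (simp_all add: A'_def)
    then show "B $$ (i, j) = four_block_mat ?E (0\<^sub>m 1 n) (0\<^sub>m n 1) A' $$ (i, j)"
      using B0[of i] B0[of j] Bsym[of i j]
      by (cases i; cases j) (auto simp: A'_def)
  qed (use B in \<open>simp_all add: A'_def\<close>)
  define F where "F = four_block_mat (1\<^sub>m 1) (0\<^sub>m 1 n) (0\<^sub>m n 1) Q'"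
  define D where "D = four_block_mat ?E (0\<^sub>m 1 n) (0\<^sub>m n 1) D'"
  have F: "F \<in> carrier_mat (Suc n) (Suc n)" using IH unfolding F_def by (intro carrier_matI) auto
  have D: "D \<in> carrier_mat (Suc n) (Suc n)" using IH unfolding D_def by (intro carrier_matI) auto
  have E: "?E \<in> carrier_mat 1 1" by simp
  have BF: "B * F = F * D"
    unfolding Bblock F_def D_def
    using IH A'(1) E by (simp add: mult_four_block_mat[where ?nr1.0=1 and ?n1.0=1 and ?n2.0=n and ?nr2.0=n and ?nc1.0=1 and ?nc2.0=n])
  have FF: "F\<^sup>T * F = 1\<^sub>m (Suc n)"
    unfolding F_def transpose_four_block_mat[OF one_carrier_mat zero_carrier_mat zero_carrier_mat IH(1)]
    using IH A'(1) by (subst mult_four_block_mat[where ?nr1.0=1 and ?n1.0=1 and ?n2.0=n and ?nr2.0=n and ?nc1.0=1 and ?nc2.0=n])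
      (auto simp: four_block_one_mat)
  have "diagonal_mat D"
    unfolding diagonal_mat_def
  proof (intro allI impI)
    fix i j assume "i < dim_row D" "j < dim_col D" "i \<noteq> j"
    then show "D $$ (i, j) = 0"
      using IH(2,3) D unfolding D_def diagonal_mat_def by (cases i; cases j) auto
  qed
  moreover have "(H * F)\<^sup>T * (H * F) = 1\<^sub>m (Suc n)"
  proof -
    have "(H * F)\<^sup>T * (H * F) = (F\<^sup>T * H) * (H * F)" using H F by (simp add: transpose_mult)
    also have "\<dots> = F\<^sup>T * ((H * H) * F)"
      using H(1) F by (simp add: assoc_mult_mat[of _ "Suc n" "Suc n" _ "Suc n" _ "Suc n"])
    finally show ?thesis using H(3) F FF by simp
  qed
  moreover have "A * (H * F) = (H * F) * D"
  proof -
    have "A * (H * F) = (H * H) * (A * (H * F))" using H(1,3) A F by simp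
    also have "\<dots> = H * (B * F)"
      using H(1) A F by (simp add: B_def assoc_mult_mat[of _ "Suc n" "Suc n" _ "Suc n" _ "Suc n"])
    also have "\<dots> = (H * F) * D"
      using H(1) D F by (simp add: BF assoc_mult_mat[of _ "Suc n" "Suc n" _ "Suc n" _ "Suc n"])
    finally show ?thesis .
  qed
  ultimately show ?case using H(1) F D by (intro exI[of _ "H * F"] exI[of _ D]) auto
qed

section \<open>Rayleigh bounds for the second smallest eigenvalue\<close>

text \<open>
  An orthonormal basis of eigenfunctions of the operator \<open>f \<mapsto> (x \<mapsto> \<Sum>y. K x y * f y)\<close> on a finite
  set. The functions \<open>q 0, \<dots>, q (N - 1)\<close> are the columns of an orthogonal matrix;
  \<open>orthonormal\<close> and \<open>complete\<close> are its two orthogonality relations.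
\<close>

locale symmetric_kernel_eigenbasis =
  fixes X :: "'a set" and K :: "'a \<Rightarrow> 'a \<Rightarrow> real" and N :: nat
    and q :: "nat \<Rightarrow> 'a \<Rightarrow> real" and d :: "nat \<Rightarrow> real"
  assumes fin: "finite X"
    and sym: "\<And>x y. x \<in> X \<Longrightarrow> y \<in> X \<Longrightarrow> K x y = K y x"
    and orthonormal: "\<And>k l. k < N \<Longrightarrow> l < N \<Longrightarrow> (\<Sum>x\<in>X. q k x * q l x) = of_bool (k = l)"
    and complete: "\<And>x y. x \<in> X \<Longrightarrow> y \<in> X \<Longrightarrow> (\<Sum>k<N. q k x * q k y) = of_bool (x = y)"
    and eigen: "\<And>k x. k < N \<Longrightarrow> x \<in> X \<Longrightarrow> (\<Sum>y\<in>X. K x y * q k y) = d k * q k x"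
begin

definition coef :: "('a \<Rightarrow> real) \<Rightarrow> nat \<Rightarrow> real" where
  "coef f k = (\<Sum>x\<in>X. f x * q k x)"

lemma parseval: "(\<Sum>x\<in>X. f x * g x) = (\<Sum>k<N. coef f k * coef g k)"
proof -
  have "(\<Sum>k<N. coef f k * coef g k) = (\<Sum>k<N. \<Sum>x\<in>X. \<Sum>y\<in>X. (f x * g y) * (q k x * q k y))"
    unfolding coef_def sum_product by (simp add: mult_ac)
  also have "\<dots> = (\<Sum>x\<in>X. \<Sum>k<N. \<Sum>y\<in>X. (f x * g y) * (q k x * q k y))"
    by (rule sum.swap)
  also have "\<dots> = (\<Sum>x\<in>X. \<Sum>y\<in>X. (f x * g y) * (\<Sum>k<N. q k x * q k y))"
    by (intro sum.cong refl, subst sum.swap) (simp add: sum_distrib_left)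
  also have "\<dots> = (\<Sum>x\<in>X. \<Sum>y\<in>X. if x = y then f x * g y else 0)"
    by (intro sum.cong refl) (simp add: complete)
  also have "\<dots> = (\<Sum>x\<in>X. f x * g x)" using fin by (intro sum.cong refl) simp
  finally show ?thesis by simp
qed

lemma form_expansion: "(\<Sum>x\<in>X. f x * (\<Sum>y\<in>X. K x y * f y)) = (\<Sum>k<N. d k * (coef f k)\<^sup>2)"
proof -
  have "coef (\<lambda>x. \<Sum>y\<in>X. K x y * f y) k = d k * coef f k" if "k < N" for k
  proof -
    have "coef (\<lambda>x. \<Sum>y\<in>X. K x y * f y) k = (\<Sum>y\<in>X. \<Sum>x\<in>X. f y * (K x y * q k x))"
      unfolding coef_def sum_distrib_right by (subst sum.swap) (simp add: mult_ac)
    also have "\<dots> = (\<Sum>y\<in>X. f y * (\<Sum>x\<in>X. K y x * q k x))"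
      unfolding sum_distrib_left by (intro sum.cong refl) (metis sym)
    also have "\<dots> = (\<Sum>y\<in>X. d k * (f y * q k y))"
      using that by (intro sum.cong refl) (simp add: eigen)
    finally show ?thesis by (simp add: coef_def sum_distrib_left)
  qed
  then show ?thesis
    unfolding parseval[of f] by (intro sum.cong refl) (simp add: power2_eq_square)
qed

text \<open>
  Two eigenfunctions span a plane, and a plane contains a nonzero function with sum zero. Its
  Rayleigh quotient is at most the larger one of the two eigenvalues.
\<close>

lemma second_eigenvalue_ge:
  assumes i: "i < N" "j < N" "i \<noteq> j" "d i \<le> d j"
    and gap: "\<And>f. (\<Sum>x\<in>X. f x) = 0 \<Longrightarrow>
      lam * (\<Sum>x\<in>X. (f x)\<^sup>2) \<le> (\<Sum>x\<in>X. f x * (\<Sum>y\<in>X. K x y * f y))"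
  shows "lam \<le> d j"
proof -
  obtain \<alpha> \<beta> :: real where ab: "\<alpha> * (\<Sum>x\<in>X. q i x) + \<beta> * (\<Sum>x\<in>X. q j x) = 0" "\<alpha> \<noteq> 0 \<or> \<beta> \<noteq> 0"
  proof (cases "(\<Sum>x\<in>X. q j x) = 0")
    case True
    then show ?thesis using that[of 0 1] by simp
  next
    case False
    then show ?thesis using that[of "(\<Sum>x\<in>X. q j x)" "- (\<Sum>x\<in>X. q i x)"] by simp
  qed
  define v where "v x = \<alpha> * q i x + \<beta> * q j x" for x
  have v0: "(\<Sum>x\<in>X. v x) = 0"
    using ab(1) by (simp add: v_def sum.distrib sum_distrib_left)
  have cv: "coef v k = (if k = i then \<alpha> else 0) + (if k = j then \<beta> else 0)" if "k < N" for k
  proof -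
    have "coef v k = \<alpha> * (\<Sum>x\<in>X. q i x * q k x) + \<beta> * (\<Sum>x\<in>X. q j x * q k x)"
      by (simp add: coef_def v_def sum_distrib_left sum.distrib algebra_simps)
    then show ?thesis using that i by (simp add: orthonormal)
  qed
  have sum2: "(\<Sum>k<N. w k * (coef v k)\<^sup>2) = w i * \<alpha>\<^sup>2 + w j * \<beta>\<^sup>2" for w :: "nat \<Rightarrow> real"
  proof -
    have "(\<Sum>k<N. w k * (coef v k)\<^sup>2) =
        (\<Sum>k<N. (if k = i then w k * \<alpha>\<^sup>2 else 0) + (if k = j then w k * \<beta>\<^sup>2 else 0))"
      using i by (intro sum.cong refl) (auto simp: cv)
    then show ?thesis using i by (simp add: sum.distrib)
  qed
  have norm: "(\<Sum>x\<in>X. (v x)\<^sup>2) = \<alpha>\<^sup>2 + \<beta>\<^sup>2"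
    using sum2[of "\<lambda>_. 1"] parseval[of v v] by (simp add: power2_eq_square)
  have "lam * (\<alpha>\<^sup>2 + \<beta>\<^sup>2) \<le> d i * \<alpha>\<^sup>2 + d j * \<beta>\<^sup>2"
    using gap[OF v0] unfolding form_expansion norm sum2 .
  also have "\<dots> \<le> d j * (\<alpha>\<^sup>2 + \<beta>\<^sup>2)"
    using i(4) by (simp add: distrib_left mult_right_mono)
  finally have "lam * (\<alpha>\<^sup>2 + \<beta>\<^sup>2) \<le> d j * (\<alpha>\<^sup>2 + \<beta>\<^sup>2)" .
  moreover have "\<alpha>\<^sup>2 + \<beta>\<^sup>2 > 0" using ab(2) by (simp add: sum_power2_gt_zero_iff)
  ultimately show ?thesis by simp
qed

text \<open>
  Dually, the plane spanned by the constants and by the test function contains a nonzero function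
  orthogonal to \<open>q i\<close>, whose Rayleigh quotient is at least every lower bound for the other
  eigenvalues.
\<close>

lemma second_eigenvalue_le:
  assumes i: "i < N" and others: "\<And>k. k < N \<Longrightarrow> k \<noteq> i \<Longrightarrow> lam \<le> d k"
    and const: "\<And>x. x \<in> X \<Longrightarrow> (\<Sum>y\<in>X. K x y) = 0"
    and f: "(\<Sum>x\<in>X. f x) = 0" "(\<Sum>x\<in>X. (f x)\<^sup>2) > 0"
    and R: "0 \<le> R" "(\<Sum>x\<in>X. f x * (\<Sum>y\<in>X. K x y * f y)) \<le> R * (\<Sum>x\<in>X. (f x)\<^sup>2)"
  shows "lam \<le> R"
proof -
  obtain \<alpha> \<beta> :: real where ab: "\<alpha> * coef (\<lambda>_. 1) i + \<beta> * coef f i = 0" "\<alpha> \<noteq> 0 \<or> \<beta> \<noteq> 0"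
  proof (cases "coef f i = 0")
    case True
    then show ?thesis using that[of 0 1] by simp
  next
    case False
    then show ?thesis using that[of "coef f i" "- coef (\<lambda>_. 1) i"] by simp
  qed
  define v where "v x = \<alpha> + \<beta> * f x" for x
  have vi: "coef v i = 0"
    using ab(1) by (simp add: coef_def v_def sum_distrib_left sum.distrib algebra_simps)
  have norm: "(\<Sum>x\<in>X. (v x)\<^sup>2) = \<alpha>\<^sup>2 * card X + \<beta>\<^sup>2 * (\<Sum>x\<in>X. (f x)\<^sup>2)"
  proof -
    have "(\<Sum>x\<in>X. (v x)\<^sup>2) = (\<Sum>x\<in>X. \<alpha>\<^sup>2 + \<beta>\<^sup>2 * (f x)\<^sup>2 + 2 * \<alpha> * \<beta> * f x)"
      by (intro sum.cong refl) (simp add: v_def power2_eq_square algebra_simps)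
    also have "\<dots> = \<alpha>\<^sup>2 * card X + \<beta>\<^sup>2 * (\<Sum>x\<in>X. (f x)\<^sup>2)"
      using f(1) by (simp add: sum.distrib sum_distrib_left[symmetric])
    finally show ?thesis .
  qed
  have Kv: "(\<Sum>y\<in>X. K x y * v y) = \<beta> * (\<Sum>y\<in>X. K x y * f y)" if "x \<in> X" for x
  proof -
    have "(\<Sum>y\<in>X. K x y * v y) = \<alpha> * (\<Sum>y\<in>X. K x y) + \<beta> * (\<Sum>y\<in>X. K x y * f y)"
      by (simp add: v_def sum.distrib sum_distrib_left algebra_simps)
    then show ?thesis using const[OF that] by simp
  qed
  have K0: "(\<Sum>x\<in>X. \<Sum>y\<in>X. K x y * f y) = 0"
  proof -
    have "(\<Sum>x\<in>X. \<Sum>y\<in>X. K x y * f y) = (\<Sum>y\<in>X. f y * (\<Sum>x\<in>X. K y x))"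
      by (subst sum.swap) (simp add: sum_distrib_left mult.commute sym cong: sum.cong)
    then show ?thesis by (simp add: const)
  qed
  have "(\<Sum>x\<in>X. v x * (\<Sum>y\<in>X. K x y * v y)) =
      (\<Sum>x\<in>X. \<alpha> * \<beta> * (\<Sum>y\<in>X. K x y * f y) + \<beta>\<^sup>2 * (f x * (\<Sum>y\<in>X. K x y * f y)))"
    by (intro sum.cong refl) (simp add: Kv, simp add: v_def algebra_simps power2_eq_square)
  also have "\<dots> = \<beta>\<^sup>2 * (\<Sum>x\<in>X. f x * (\<Sum>y\<in>X. K x y * f y))"
    using K0 by (simp add: sum.distrib sum_distrib_left[symmetric])
  also have "\<dots> \<le> \<beta>\<^sup>2 * (R * (\<Sum>x\<in>X. (f x)\<^sup>2))" using R(2) by (intro mult_left_mono) auto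
  also have "\<dots> \<le> R * (\<Sum>x\<in>X. (v x)\<^sup>2)" using R(1) unfolding norm by (simp add: algebra_simps)
  finally have 1: "(\<Sum>k<N. d k * (coef v k)\<^sup>2) \<le> R * (\<Sum>x\<in>X. (v x)\<^sup>2)"
    unfolding form_expansion .
  have "lam * (\<Sum>x\<in>X. (v x)\<^sup>2) = (\<Sum>k<N. lam * (coef v k)\<^sup>2)"
    using parseval[of v v] by (simp add: power2_eq_square sum_distrib_left)
  also have "\<dots> \<le> (\<Sum>k<N. d k * (coef v k)\<^sup>2)"
    using vi others by (intro sum_mono) (metis lessThan_iff mult_right_mono mult_zero_right order_refl
        power_zero_numeral zero_le_power2)
  finally have "lam * (\<Sum>x\<in>X. (v x)\<^sup>2) \<le> R * (\<Sum>x\<in>X. (v x)\<^sup>2)" using 1 by simp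
  moreover have "(\<Sum>x\<in>X. (v x)\<^sup>2) > 0"
  proof -
    have "card X > 0" using f(2) fin by (intro Suc_leI card_gt_0_iff[THEN iffD2]) (auto simp: card_gt_0_iff)
    then show ?thesis unfolding norm using ab(2) f(2)
      by (cases "\<beta> = 0") (auto intro: add_nonneg_pos mult_pos_pos)
  qed
  ultimately show ?thesis by simp
qed

end

lemma symmetric_kernel_has_eigenbasis:
  fixes K :: "'a \<Rightarrow> 'a \<Rightarrow> real"
  assumes vs: "distinct vs" "set vs = X"
    and sym: "\<And>x y. x \<in> X \<Longrightarrow> y \<in> X \<Longrightarrow> K x y = K y x"
  obtains q d where "symmetric_kernel_eigenbasis X K (length vs) q d"
    and "char_poly (mat (length vs) (length vs) (\<lambda>(i, j). K (vs ! i) (vs ! j))) =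
      (\<Prod>k<length vs. [:- d k, 1:])"
proof -
  let ?N = "length vs"
  define A where "A = mat ?N ?N (\<lambda>(i, j). K (vs ! i) (vs ! j))"
  have A: "A \<in> carrier_mat ?N ?N" by (simp add: A_def)
  have "A\<^sup>T = A" using vs(2) by (intro eq_matI) (auto simp: A_def intro!: sym)
  then obtain Q D where Q: "Q \<in> carrier_mat ?N ?N" and D: "D \<in> carrier_mat ?N ?N" "diagonal_mat D"
    and QQ: "Q\<^sup>T * Q = 1\<^sub>m ?N" and AQ: "A * Q = Q * D"
    using symmetric_mat_orthogonally_diagonalizable[OF A] by blast
  have QT: "Q\<^sup>T \<in> carrier_mat ?N ?N" using Q by simp
  have QQ': "Q * Q\<^sup>T = 1\<^sub>m ?N" using mat_mult_left_right_inverse[OF QT Q QQ] .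
  define pos where "pos = the_inv_into {..<?N} ((!) vs)"
  have bij: "bij_betw ((!) vs) {..<?N} X" using bij_betw_nth[OF vs(1) refl] vs(2) by simp
  have pos_nth: "pos (vs ! i) = i" if "i < ?N" for i
    using that bij by (simp add: pos_def the_inv_into_f_f bij_betw_def)
  have pos: "pos x < ?N" "vs ! pos x = x" if x: "x \<in> X" for x
  proof -
    obtain i where "i < ?N" "vs ! i = x" using x vs(2) by (metis in_set_conv_nth)
    then show "pos x < ?N" "vs ! pos x = x" using pos_nth by auto
  qed
  have sum_X: "(\<Sum>x\<in>X. g x) = (\<Sum>i<?N. g (vs ! i))" for g :: "'a \<Rightarrow> real"
    using sum.reindex_bij_betw[OF bij, of g] by simp
  define q where "q k x = Q $$ (pos x, k)" for k x
  define d where "d k = D $$ (k, k)" for k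
  have "symmetric_kernel_eigenbasis X K ?N q d"
  proof
    show "finite X" using vs(2) by auto
  next
    show "K x y = K y x" if "x \<in> X" "y \<in> X" for x y using that by (rule sym)
  next
    fix k l assume kl: "k < ?N" "l < ?N"
    have "(\<Sum>x\<in>X. q k x * q l x) = (Q\<^sup>T * Q) $$ (k, l)"
      using kl Q by (simp add: sum_X q_def pos_nth scalar_prod_def flip: lessThan_atLeast0)
    then show "(\<Sum>x\<in>X. q k x * q l x) = of_bool (k = l)" using kl by (simp add: QQ)
  next
    fix x y assume xy: "x \<in> X" "y \<in> X"
    have "(\<Sum>k<?N. q k x * q k y) = (Q * Q\<^sup>T) $$ (pos x, pos y)"
      using pos[OF xy(1)] pos[OF xy(2)] Q by (simp add: q_def scalar_prod_def lessThan_atLeast0)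
    also have "\<dots> = of_bool (pos x = pos y)" using pos xy by (simp add: QQ')
    also have "pos x = pos y \<longleftrightarrow> x = y" using pos xy by metis
    finally show "(\<Sum>k<?N. q k x * q k y) = of_bool (x = y)" .
  next
    fix k x assume k: "k < ?N" and x: "x \<in> X"
    have "(\<Sum>y\<in>X. K x y * q k y) = (A * Q) $$ (pos x, k)"
      using k pos[OF x] Q by (simp add: sum_X q_def pos_nth A_def scalar_prod_def flip: lessThan_atLeast0)
    also have "\<dots> = (\<Sum>l<?N. Q $$ (pos x, l) * D $$ (l, k))"
      using k pos[OF x] Q D by (simp add: AQ scalar_prod_def lessThan_atLeast0)
    also have "\<dots> = (\<Sum>l<?N. if l = k then Q $$ (pos x, k) * D $$ (k, k) else 0)"
      using k D by (intro sum.cong refl) (auto simp: diagonal_mat_def)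
    also have "\<dots> = d k * q k x" using k by (simp add: q_def d_def)
    finally show "(\<Sum>y\<in>X. K x y * q k y) = d k * q k x" .
  qed
  moreover have "char_poly A = (\<Prod>k<?N. [:- d k, 1:])"
  proof -
    have "A = Q * D * Q\<^sup>T"
      using A Q QT D(1) QQ' AQ by (metis assoc_mult_mat right_mult_one_mat)
    then have "similar_mat A D"
      unfolding similar_mat_def similar_mat_wit_def Let_def
      using A Q QT D(1) QQ QQ' by (intro exI[of _ Q] exI[of _ "Q\<^sup>T"]) auto
    then have "char_poly A = char_poly D" by (rule char_poly_similar)
    also have "\<dots> = (\<Prod>a\<leftarrow>diag_mat D. [:- a, 1:])"
      using D by (intro char_poly_upper_triangular) (auto simp: diagonal_mat_def)
    also have "\<dots> = (\<Prod>k<?N. [:- d k, 1:])"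
      using D(1) by (simp add: diag_mat_def d_def comp_def prod.distinct_set_conv_list[symmetric] lessThan_atLeast0)
    finally show ?thesis .
  qed
  ultimately show ?thesis using that[of q d] by (simp add: A_def)
qed

lemma proots_prod_linear: "proots (\<Prod>k<N. [:- d k, 1:]) = mset (map d [0..<N])" for d :: "nat \<Rightarrow> real"
proof -
  have "proots (\<Prod>k<N. [:- d k, 1:]) = (\<Sum>k<N. {#d k#})"
    by (subst proots_prod) simp_all
  also have "\<dots> = mset (map d [0..<N])" by (induction N) simp_all
  finally show ?thesis .
qed

text \<open>
  Translates the second entry of the sorted list of eigenvalues into indices of the unsorted
  family, the form in which the Rayleigh bounds refer to eigenvalues.
\<close>

lemma second_smallest_index:
  fixes d :: "nat \<Rightarrow> real"
  assumes "N \<ge> 2"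
  obtains i j where "i < N" "j < N" "i \<noteq> j" "d i \<le> d j" "\<And>k. k < N \<Longrightarrow> k \<noteq> i \<Longrightarrow> d j \<le> d k"
    and "sorted_list_of_multiset (mset (map d [0..<N])) ! 1 = d j"
proof -
  define e where "e = sort (map d [0..<N])"
  have "mset e = mset (map d [0..<N])" by (simp add: e_def)
  then obtain p where p: "p permutes {..<N}" "permute_list p (map d [0..<N]) = e"
    by (metis length_map length_upt minus_nat.diff_0 mset_eq_permutation)
  have e: "e ! i = d (p i)" if "i < N" for i
    using that p(1) permutes_in_image[OF p(1), of i] unfolding p(2)[symmetric]
    by (simp add: permute_list_nth)
  have len: "length e = N" by (simp add: e_def)
  have sorted: "sorted e" by (simp add: e_def)
  show ?thesis
  proof (rule that[of "p 0" "p 1"])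
    show "p 0 < N" "p 1 < N" using assms permutes_in_image[OF p(1)] by auto
    show "p 0 \<noteq> p 1" using permutes_inj[OF p(1)] by (metis injD zero_neq_one)
    show "d (p 0) \<le> d (p 1)" using assms sorted_nth_mono[OF sorted, of 0 1] len by (simp add: e)
    show "sorted_list_of_multiset (mset (map d [0..<N])) ! 1 = d (p 1)"
      using assms e[of 1] by (simp only: sorted_list_of_multiset_mset e_def)
    fix k assume k: "k < N" "k \<noteq> p 0"
    then obtain l where l: "l < N" "k = p l"
      using p(1) by (metis lessThan_iff permutes_def)
    with k have "1 \<le> l" by (cases l) auto
    then show "d (p 1) \<le> d k" using sorted_nth_mono[OF sorted, of 1 l] len l assms by (simp add: e)
  qed
qed

section \<open>A single pancake moving on positions and colors\<close>

text \<open>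
  Functions on \<open>\<int>\<^sub>m\<close> are represented as \<open>m\<close>-periodic functions on the integers, so that color shifts
  need no reduction modulo \<open>m\<close>.
\<close>

definition periodic :: "nat \<Rightarrow> (int \<Rightarrow> real) \<Rightarrow> bool" where
  "periodic m h \<longleftrightarrow> (\<forall>c. h (c + int m) = h c)"

lemma periodic_cong_mod:
  assumes "periodic m h"
  shows "h (c mod int m) = h c"
proof -
  have step: "h (c + int m * int k) = h c" for c k
  proof (induction k)
    case (Suc k)
    have "h (c + int m * int (Suc k)) = h ((c + int m * int k) + int m)"
      by (simp add: algebra_simps)
    then show ?case using Suc assms by (simp add: periodic_def)
  qed simp
  have "h (c + int m * k) = h c" for c k
  proof (cases "k \<ge> 0")
    case True
    then show ?thesis using step[of c "nat k"] by simp
  next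
    case False
    then show ?thesis using step[of "c + int m * k" "nat (- k)"] by (simp add: algebra_simps)
  qed
  from this[of "c mod int m" "c div int m"] show ?thesis by simp
qed

lemma sum_periodic_shift:
  assumes "m > 0" and h: "periodic m h"
  shows "(\<Sum>c\<in>{0..<int m}. h (c + a)) = (\<Sum>c\<in>{0..<int m}. h c)"
proof (rule sum.reindex_bij_witness[where i = "\<lambda>c. (c - a) mod int m" and j = "\<lambda>c. (c + a) mod int m"])
  fix c assume "c \<in> {0..<int m}"
  then show "((c + a) mod int m - a) mod int m = c" "((c - a) mod int m + a) mod int m = c"
    by (simp_all add: mod_simps)
qed (use assms in \<open>simp_all add: periodic_cong_mod\<close>)

lemma sum_times_complement: "6 * (\<Sum>d<m. real d * (real m - real d)) = real m * ((real m)\<^sup>2 - 1)"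
proof -
  \<comment> \<open>Induction needs the length of the sum and the parameter \<open>x = m\<close> to be independent.\<close>
  have "6 * (\<Sum>d<k. real d * (x - real d)) = real k * (real k - 1) * (3 * x - 2 * real k + 1)" for k x
    by (induction k) (simp_all add: algebra_simps)
  from this[where k = m and x = "real m"] show ?thesis
    by (simp add: algebra_simps power2_eq_square)
qed

lemma square_sum_lessThan_le:
  fixes f :: "nat \<Rightarrow> real"
  shows "(\<Sum>k<d. f k)\<^sup>2 \<le> real d * (\<Sum>k<d. (f k)\<^sup>2)"
proof (cases "d = 0")
  case False
  let ?S = "\<Sum>k<d. f k"
  \<comment> \<open>The variance of \<open>f\<close>, scaled by \<open>d\<close> to avoid a division, is nonnegative.\<close>
  have "0 \<le> (\<Sum>k<d. (real d * f k - ?S)\<^sup>2)" by (intro sum_nonneg) simp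
  also have "\<dots> = (\<Sum>k<d. (real d)\<^sup>2 * (f k)\<^sup>2 - 2 * real d * ?S * f k + ?S\<^sup>2)"
    by (intro sum.cong refl) (simp add: power2_eq_square algebra_simps)
  also have "\<dots> = (real d)\<^sup>2 * (\<Sum>k<d. (f k)\<^sup>2) - 2 * real d * ?S * ?S + real d * ?S\<^sup>2"
    by (simp add: sum.distrib sum_subtractf flip: sum_distrib_left)
  also have "\<dots> = real d * (real d * (\<Sum>k<d. (f k)\<^sup>2) - ?S\<^sup>2)"
    by (simp add: power2_eq_square algebra_simps)
  finally show ?thesis using False by (simp add: zero_le_mult_iff)
qed simp

text \<open>
  The squared differences \<open>T d\<close> at distance \<open>d\<close> are at most \<open>d\<^sup>2 D\<close> by Cauchy-Schwarz along one arc
  of the cycle, and at most \<open>(m - d)\<^sup>2 D\<close> along the other arc, hence at most \<open>d (m - d) D\<close>. The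
  sum of all \<open>T d\<close> is \<open>2 m\<close> times the squared norm. The resulting constant \<open>12 / (m\<^sup>2 - 1)\<close> is
  below the optimal \<open>4 sin\<^sup>2 (\<pi> / m)\<close> for \<open>m > 2\<close>, but has the order \<open>1 / m\<^sup>2\<close> needed for
  \<open>color_energy_bound\<close>.
\<close>

lemma cycle_poincare:
  assumes "m > 0" and h: "periodic m h" and zero: "(\<Sum>c\<in>{0..<int m}. h c) = 0"
  shows "12 * (\<Sum>c\<in>{0..<int m}. (h c)\<^sup>2) \<le> ((real m)\<^sup>2 - 1) * (\<Sum>c\<in>{0..<int m}. (h (c + 1) - h c)\<^sup>2)"
proof -
  let ?C = "{0..<int m}"
  define D where "D = (\<Sum>c\<in>?C. (h (c + 1) - h c)\<^sup>2)"
  define T where "T d = (\<Sum>c\<in>?C. (h (c + int d) - h c)\<^sup>2)" for d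
  define S where "S = (\<Sum>c\<in>?C. (h c)\<^sup>2)"
  have D: "D \<ge> 0" unfolding D_def by (intro sum_nonneg) simp
  have per: "periodic m (\<lambda>c. h (c + a))" for a
    using h by (simp add: periodic_def add.assoc add.commute[of "int m"] flip: add.assoc) (metis add.assoc add.commute)
  have bound: "T d \<le> (real d)\<^sup>2 * D" for d
  proof -
    have "(h (c + int d) - h c)\<^sup>2 \<le> real d * (\<Sum>k<d. (h (c + int k + 1) - h (c + int k))\<^sup>2)" for c
    proof -
      have "h (c + int d) - h c = (\<Sum>k<d. h (c + int k + 1) - h (c + int k))"
        using sum_lessThan_telescope[of "\<lambda>k. h (c + int k)" d] by (simp add: algebra_simps)
      then show ?thesis
        using square_sum_lessThan_le[of "\<lambda>k. h (c + int k + 1) - h (c + int k)" d] by simp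
    qed
    then have "T d \<le> (\<Sum>c\<in>?C. real d * (\<Sum>k<d. (h (c + int k + 1) - h (c + int k))\<^sup>2))"
      unfolding T_def by (intro sum_mono) auto
    also have "\<dots> = real d * (\<Sum>k<d. \<Sum>c\<in>?C. (h (c + int k + 1) - h (c + int k))\<^sup>2)"
      unfolding sum_distrib_left[symmetric] by (subst sum.swap) simp
    also have "\<dots> = real d * (\<Sum>k<d. D)"
    proof (intro arg_cong[of _ _ "(*) (real d)"] sum.cong refl)
      fix k
      have "periodic m (\<lambda>c. (h (c + 1) - h c)\<^sup>2)" using per[of 1] h by (simp add: periodic_def)
      from sum_periodic_shift[OF assms(1) this, of "int k"]
      show "(\<Sum>c\<in>?C. (h (c + int k + 1) - h (c + int k))\<^sup>2) = D" by (simp add: D_def)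
    qed
    finally show ?thesis by (simp add: power2_eq_square)
  qed
  have reflect: "T (m - d) = T d" if "d \<le> m" for d
  proof -
    have "periodic m (\<lambda>c. (h (c + int (m - d)) - h c)\<^sup>2)" using per[of "int (m - d)"] h by (simp add: periodic_def)
    from sum_periodic_shift[OF assms(1) this, of "int d"]
    have "T (m - d) = (\<Sum>c\<in>?C. (h (c + int m) - h (c + int d))\<^sup>2)"
      using that by (simp add: T_def of_nat_diff algebra_simps)
    also have "\<dots> = T d" using h unfolding T_def periodic_def by (simp add: power2_commute)
    finally show ?thesis .
  qed
  have key: "T d \<le> real d * (real m - real d) * D" if "d < m" for d
  proof -
    have "T d \<le> (real m - real d)\<^sup>2 * D"
      using bound[of "m - d"] reflect[of d] that by (simp add: of_nat_diff)
    moreover have "T d \<le> (real d)\<^sup>2 * D" by (rule bound)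
    moreover have "(real d)\<^sup>2 \<le> real d * (real m - real d) \<or> (real m - real d)\<^sup>2 \<le> real d * (real m - real d)"
      using that unfolding power2_eq_square
      by (cases "real d \<le> real m - real d") (auto intro: mult_left_mono mult_right_mono)
    ultimately show ?thesis using D by (meson mult_right_mono order_trans)
  qed
  have "2 * real m * S = (\<Sum>d<m. T d)"
  proof -
    have "(\<Sum>d<m. T d) = (\<Sum>d<m. \<Sum>c\<in>?C. ((h (c + int d))\<^sup>2 + (h c)\<^sup>2) - 2 * (h c * h (c + int d)))"
      unfolding T_def by (intro sum.cong refl) (simp add: power2_eq_square algebra_simps)
    also have "\<dots> = (\<Sum>d<m. (S + S) - 2 * (\<Sum>c\<in>?C. h c * h (c + int d)))"
    proof (intro sum.cong refl)
      fix d
      have "periodic m (\<lambda>c. (h c)\<^sup>2)" using h by (simp add: periodic_def)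
      from sum_periodic_shift[OF assms(1) this, of "int d"]
      show "(\<Sum>c\<in>?C. ((h (c + int d))\<^sup>2 + (h c)\<^sup>2) - 2 * (h c * h (c + int d))) =
          (S + S) - 2 * (\<Sum>c\<in>?C. h c * h (c + int d))"
        by (simp add: sum_subtractf sum.distrib S_def sum_distrib_left)
    qed
    also have "\<dots> = 2 * real m * S - 2 * (\<Sum>d<m. \<Sum>c\<in>?C. h c * h (c + int d))"
      by (simp add: sum_subtractf flip: sum_distrib_left)
    also have "(\<Sum>d<m. \<Sum>c\<in>?C. h c * h (c + int d)) = (\<Sum>c\<in>?C. h c * (\<Sum>d<m. h (c + int d)))"
      by (subst sum.swap) (simp add: sum_distrib_left)
    also have "\<dots> = (\<Sum>c\<in>?C. h c * 0)"
    proof (intro sum.cong refl arg_cong[of _ _ "(*) _"])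
      fix c
      have "(\<Sum>d<m. h (c + int d)) = (\<Sum>d\<in>?C. h (d + c))"
        by (rule sum.reindex_bij_witness[where i = nat and j = int]) (auto simp: add.commute)
      then show "(\<Sum>d<m. h (c + int d)) = 0" using sum_periodic_shift[OF assms(1) h, of c] zero by simp
    qed
    finally show ?thesis by simp
  qed
  also have "\<dots> \<le> (\<Sum>d<m. real d * (real m - real d) * D)" using key by (intro sum_mono) simp
  also have "\<dots> = real m * ((real m)\<^sup>2 - 1) / 6 * D"
    using sum_times_complement[of m] by (simp add: sum_distrib_right[symmetric])
  finally have "real m * (12 * S) \<le> real m * (((real m)\<^sup>2 - 1) * D)" by simp
  then show ?thesis using assms(1) by (simp add: S_def D_def)
qed

text \<open>
  Energy of the moves that raise the color by one and lead from a position where the function is \<open>u\<close>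
  to a position where it is \<open>v\<close>.
\<close>

definition flip_energy :: "nat \<Rightarrow> (int \<Rightarrow> real) \<Rightarrow> (int \<Rightarrow> real) \<Rightarrow> real" where
  "flip_energy m u v = (\<Sum>c\<in>{0..<int m}. (u c - v (c + 1))\<^sup>2)"

lemma flip_energy_nonneg: "flip_energy m u v \<ge> 0"
  unfolding flip_energy_def by (intro sum_nonneg) simp

lemma norm_le_flip_energy:
  assumes "m > 0" "periodic m v"
  shows "(\<Sum>c\<in>{0..<int m}. (v c)\<^sup>2) \<le> 2 * (\<Sum>c\<in>{0..<int m}. (u c)\<^sup>2) + 2 * flip_energy m u v"
proof -
  have "periodic m (\<lambda>c. (v c)\<^sup>2)" using assms by (simp add: periodic_def)
  from sum_periodic_shift[OF assms(1) this, of 1]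
  have "(\<Sum>c\<in>{0..<int m}. (v c)\<^sup>2) = (\<Sum>c\<in>{0..<int m}. (v (c + 1))\<^sup>2)" by simp
  also have "\<dots> \<le> (\<Sum>c\<in>{0..<int m}. 2 * (u c)\<^sup>2 + 2 * (u c - v (c + 1))\<^sup>2)"
  proof (rule sum_mono)
    fix c
    have "0 \<le> (2 * u c - v (c + 1))\<^sup>2" by simp
    then show "(v (c + 1))\<^sup>2 \<le> 2 * (u c)\<^sup>2 + 2 * (u c - v (c + 1))\<^sup>2"
      by (simp add: power2_eq_square algebra_simps)
  qed
  finally show ?thesis by (simp add: flip_energy_def sum.distrib sum_distrib_left)
qed

lemma norm_le_flip_energy':
  assumes "m > 0" "periodic m u"
  shows "(\<Sum>c\<in>{0..<int m}. (v c)\<^sup>2) \<le> 2 * (\<Sum>c\<in>{0..<int m}. (u c)\<^sup>2) + 2 * flip_energy m v u"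
proof -
  have "periodic m (\<lambda>c. (u c)\<^sup>2)" using assms by (simp add: periodic_def)
  from sum_periodic_shift[OF assms(1) this, of 1]
  have eq: "(\<Sum>c\<in>{0..<int m}. (u c)\<^sup>2) = (\<Sum>c\<in>{0..<int m}. (u (c + 1))\<^sup>2)" by simp
  have "(\<Sum>c\<in>{0..<int m}. (v c)\<^sup>2) \<le> (\<Sum>c\<in>{0..<int m}. 2 * (u (c + 1))\<^sup>2 + 2 * (v c - u (c + 1))\<^sup>2)"
  proof (rule sum_mono)
    fix c
    have "0 \<le> (2 * u (c + 1) - v c)\<^sup>2" by simp
    then show "(v c)\<^sup>2 \<le> 2 * (u (c + 1))\<^sup>2 + 2 * (v c - u (c + 1))\<^sup>2"
      by (simp add: power2_eq_square algebra_simps)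
  qed
  then show ?thesis unfolding eq by (simp add: flip_energy_def sum.distrib sum_distrib_left)
qed

text \<open>
  Groups the positions into the orbits of the reversal \<open>j \<mapsto> p + 1 - j\<close>.
\<close>

lemma sum_pair_reflected:
  fixes \<phi> :: "nat \<Rightarrow> real"
  shows "(\<Sum>j\<in>{1..p}. \<phi> j) = (\<Sum>j\<in>{j \<in> {1..p}. 2 * j < p + 1}. \<phi> j + \<phi> (p + 1 - j))
    + (\<Sum>j\<in>{j \<in> {1..p}. 2 * j = p + 1}. \<phi> j)"
proof -
  let ?L = "{j \<in> {1..p}. 2 * j < p + 1}" and ?M = "{j \<in> {1..p}. 2 * j = p + 1}"
    and ?H = "{j \<in> {1..p}. 2 * j > p + 1}"
  have "{1..p} = ?L \<union> ?M \<union> ?H" by auto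
  then have "(\<Sum>j\<in>{1..p}. \<phi> j) = (\<Sum>j\<in>?L \<union> ?M \<union> ?H. \<phi> j)" by (rule arg_cong)
  also have "\<dots> = (\<Sum>j\<in>?L. \<phi> j) + (\<Sum>j\<in>?M. \<phi> j) + (\<Sum>j\<in>?H. \<phi> j)"
    by (subst sum.union_disjoint; (subst sum.union_disjoint)?) auto
  also have "(\<Sum>j\<in>?H. \<phi> j) = (\<Sum>j\<in>?L. \<phi> (p + 1 - j))"
    by (rule sum.reindex_bij_witness[where i = "\<lambda>j. p + 1 - j" and j = "\<lambda>j. p + 1 - j"]) auto
  finally show ?thesis by (simp add: sum.distrib)
qed

text \<open>
  For each \<open>i \<ge> 2\<close> the terms \<open>j = 1\<close> and \<open>j = i\<close> contribute \<open>2 (g 1 - g i)\<^sup>2\<close>, and among all constants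
  the mean of \<open>g\<close>, here zero, has the least squared distance to \<open>g\<close>.
\<close>

lemma position_energy_bound:
  fixes g :: "nat \<Rightarrow> real"
  assumes "(\<Sum>j\<in>{1..p}. g j) = 0"
  shows "2 * (\<Sum>j\<in>{1..p}. (g j)\<^sup>2) \<le> (\<Sum>i\<in>{1..p}. \<Sum>j\<in>{1..i}. (g j - g (i + 1 - j))\<^sup>2)"
proof -
  have "2 * (g 1 - g i)\<^sup>2 \<le> (\<Sum>j\<in>{1..i}. (g j - g (i + 1 - j))\<^sup>2)" if "i \<ge> 1" for i
  proof (cases "i = 1")
    case False
    have "2 * (g 1 - g i)\<^sup>2 = (\<Sum>j\<in>{1, i}. (g j - g (i + 1 - j))\<^sup>2)"
      using False that by (simp add: power2_commute)
    also have "\<dots> \<le> (\<Sum>j\<in>{1..i}. (g j - g (i + 1 - j))\<^sup>2)"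
      using that by (intro sum_mono2) auto
    finally show ?thesis .
  qed simp
  then have "(\<Sum>i\<in>{1..p}. 2 * (g 1 - g i)\<^sup>2) \<le> (\<Sum>i\<in>{1..p}. \<Sum>j\<in>{1..i}. (g j - g (i + 1 - j))\<^sup>2)"
    by (intro sum_mono) auto
  moreover have "(\<Sum>i\<in>{1..p}. 2 * (g 1 - g i)\<^sup>2) = (\<Sum>i\<in>{1..p}. 2 * (g 1)\<^sup>2 - 4 * g 1 * g i + 2 * (g i)\<^sup>2)"
    by (intro sum.cong refl) (simp add: power2_eq_square algebra_simps)
  moreover have "\<dots> = 2 * real p * (g 1)\<^sup>2 + 2 * (\<Sum>i\<in>{1..p}. (g i)\<^sup>2)"
    using assms by (simp add: sum.distrib sum_subtractf sum_distrib_left[symmetric])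
  moreover have "0 \<le> 2 * real p * (g 1)\<^sup>2" by simp
  ultimately show ?thesis by linarith
qed

text \<open>
  Two kinds of moves are used. Position \<open>j\<close> with \<open>2 j \<le> p + 1\<close> is fixed by the flip of
  length \<open>2 j - 1\<close>, so its color walks on the \<open>m\<close>-cycle and \<open>loop\<close> applies. The flip of length \<open>p\<close>
  exchanges \<open>j\<close> and \<open>p + 1 - j\<close>, and the triangle inequality transfers the bound to the
  other position. The pairs \<open>(2 j - 1, j)\<close> with \<open>2 j < p + 1\<close> do not meet the pairs \<open>(p, j)\<close>, so
  no term is counted twice.
\<close>

lemma color_energy_bound:
  fixes h :: "nat \<Rightarrow> int \<Rightarrow> real"
  assumes m: "m \<ge> 2" and per: "\<And>j. periodic m (h j)"
    and zero: "\<And>j. (\<Sum>c\<in>{0..<int m}. h j c) = 0"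
  shows "4 * (\<Sum>j\<in>{1..p}. \<Sum>c\<in>{0..<int m}. (h j c)\<^sup>2) \<le>
    (real m)\<^sup>2 * (\<Sum>i\<in>{1..p}. \<Sum>j\<in>{1..i}. flip_energy m (h j) (h (i + 1 - j)))"
proof -
  define W where "W j = (\<Sum>c\<in>{0..<int m}. (h j c)\<^sup>2)" for j
  define P where "P j t = flip_energy m (h j) (h t)" for j t
  let ?L = "{j \<in> {1..p}. 2 * j < p + 1}" and ?M = "{j \<in> {1..p}. 2 * j = p + 1}"
  have m0: "m > 0" using m by simp
  have P: "P j t \<ge> 0" for j t by (simp add: P_def flip_energy_nonneg)
  have m4: "(real m)\<^sup>2 \<ge> 4" using power_mono[of 2 "real m" 2] m by simp
  have loop: "12 * W j \<le> ((real m)\<^sup>2 - 1) * P j j" for j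
    using cycle_poincare[OF m0 per zero, of j] by (simp add: W_def P_def flip_energy_def power2_commute)
  have pair: "4 * (W j + W t) \<le> (real m)\<^sup>2 * (P j j + P j t + P t j)" for j t
  proof -
    have "W t \<le> 2 * W j + 2 * P j t" "W t \<le> 2 * W j + 2 * P t j"
      using norm_le_flip_energy[OF m0 per] norm_le_flip_energy'[OF m0 per] by (simp_all add: W_def P_def)
    \<comment> \<open>The average of the two bounds gives \<open>W j + W t \<le> 3 W j + P j t + P t j\<close>, and \<open>12 W j\<close> is bounded by \<open>loop\<close>.\<close>
    then have "4 * (W j + W t) \<le> ((real m)\<^sup>2 - 1) * P j j + 4 * (P j t + P t j)" using loop[of j] by simp
    also have "\<dots> \<le> (real m)\<^sup>2 * P j j + (real m)\<^sup>2 * (P j t + P t j)"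
      using m4 P by (intro add_mono mult_right_mono add_nonneg_nonneg) auto
    finally show ?thesis by (simp add: algebra_simps)
  qed
  have mid: "4 * W j \<le> (real m)\<^sup>2 * P j j" for j
  proof -
    have "W j \<ge> 0" unfolding W_def by (intro sum_nonneg) simp
    moreover have "((real m)\<^sup>2 - 1) * P j j \<le> (real m)\<^sup>2 * P j j" using P by (intro mult_right_mono) auto
    ultimately show ?thesis using loop[of j] by linarith
  qed
  have "4 * (\<Sum>j\<in>{1..p}. W j) = (\<Sum>j\<in>?L. 4 * (W j + W (p + 1 - j))) + (\<Sum>j\<in>?M. 4 * W j)"
    unfolding sum_pair_reflected[of W] by (simp add: sum_distrib_left)
  also have "\<dots> \<le> (\<Sum>j\<in>?L. (real m)\<^sup>2 * (P j j + P j (p + 1 - j) + P (p + 1 - j) j))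
      + (\<Sum>j\<in>?M. (real m)\<^sup>2 * P j (p + 1 - j))"
  proof (intro add_mono sum_mono)
    fix j assume "j \<in> ?M"
    then have "p + 1 - j = j" by auto
    then show "4 * W j \<le> (real m)\<^sup>2 * P j (p + 1 - j)" using mid by simp
  qed (rule pair)
  also have "\<dots> = (real m)\<^sup>2 * ((\<Sum>j\<in>?L. P j j) + (\<Sum>j\<in>{1..p}. P j (p + 1 - j)))"
  proof -
    have "(\<Sum>j\<in>?L. P j (p + 1 - j) + P (p + 1 - j) j) =
        (\<Sum>j\<in>?L. P j (p + 1 - j) + P (p + 1 - j) (p + 1 - (p + 1 - j)))"
      by (intro sum.cong refl) auto
    then show ?thesis
      unfolding sum_pair_reflected[of "\<lambda>j. P j (p + 1 - j)"]
      by (simp add: sum_distrib_left sum.distrib algebra_simps)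
  qed
  also have "\<dots> \<le> (real m)\<^sup>2 * (\<Sum>i\<in>{1..p}. \<Sum>j\<in>{1..i}. P j (i + 1 - j))"
  proof (cases p)
    case (Suc r)
    have "(\<Sum>j\<in>?L. P j j) = (\<Sum>x\<in>(\<lambda>j. (2 * j - 1, j)) ` ?L. case x of (i, j) \<Rightarrow> P j (i + 1 - j))"
      by (subst sum.reindex) (auto simp: inj_on_def mult_2 intro!: sum.cong)
    also have "\<dots> \<le> (\<Sum>x\<in>Sigma {1..r} (\<lambda>i. {1..i}). case x of (i, j) \<Rightarrow> P j (i + 1 - j))"
      using P Suc by (intro sum_mono2) auto
    also have "\<dots> = (\<Sum>i\<in>{1..r}. \<Sum>j\<in>{1..i}. P j (i + 1 - j))"
      by (subst sum.Sigma) auto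
    finally have "(\<Sum>j\<in>?L. P j j) + (\<Sum>j\<in>{1..p}. P j (p + 1 - j)) \<le>
        (\<Sum>i\<in>{1..p}. \<Sum>j\<in>{1..i}. P j (i + 1 - j))"
      unfolding Suc by simp
    then show ?thesis by (intro mult_left_mono) auto
  qed simp
  finally show ?thesis by (simp add: W_def P_def)
qed

text \<open>
  Separates the mean over the colors at each position from the rest. The mixed terms vanish since
  the rest sums to zero over the colors, so that the two preceding bounds add up.
\<close>

lemma quotient_energy_bound:
  fixes G :: "nat \<Rightarrow> int \<Rightarrow> real"
  assumes m: "m \<ge> 2" and per: "\<And>j. periodic m (G j)"
    and zero: "(\<Sum>j\<in>{1..p}. \<Sum>c\<in>{0..<int m}. G j c) = 0"
  shows "4 * (\<Sum>j\<in>{1..p}. \<Sum>c\<in>{0..<int m}. (G j c)\<^sup>2) \<le>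
    (real m)\<^sup>2 * (\<Sum>i\<in>{1..p}. \<Sum>j\<in>{1..i}. flip_energy m (G j) (G (i + 1 - j)))"
proof -
  let ?C = "{0..<int m}"
  define g where "g j = (\<Sum>c\<in>?C. G j c) / real m" for j
  define h where "h j c = G j c - g j" for j c
  have m0: "m > 0" using m by simp
  have h_per: "periodic m (h j)" for j using per[of j] by (simp add: periodic_def h_def)
  have h_zero: "(\<Sum>c\<in>?C. h j c) = 0" for j using m0 by (simp add: h_def sum_subtractf g_def)
  have "(\<Sum>j\<in>{1..p}. g j) = 0" using zero by (simp add: g_def sum_divide_distrib[symmetric])
  note pos = position_energy_bound[OF this]
  have norm: "(\<Sum>c\<in>?C. (G j c)\<^sup>2) = real m * (g j)\<^sup>2 + (\<Sum>c\<in>?C. (h j c)\<^sup>2)" for j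
  proof -
    have "(\<Sum>c\<in>?C. (G j c)\<^sup>2) = (\<Sum>c\<in>?C. (g j)\<^sup>2 + (h j c)\<^sup>2 + 2 * g j * h j c)"
      by (intro sum.cong refl) (simp add: h_def power2_eq_square algebra_simps)
    then show ?thesis using h_zero[of j] by (simp add: sum.distrib sum_distrib_left[symmetric])
  qed
  have energy: "flip_energy m (G j) (G t) = real m * (g j - g t)\<^sup>2 + flip_energy m (h j) (h t)" for j t
  proof -
    have "flip_energy m (G j) (G t) = (\<Sum>c\<in>?C. (g j - g t)\<^sup>2 + (h j c - h t (c + 1))\<^sup>2
        + (2 * (g j - g t) * h j c - 2 * (g j - g t) * h t (c + 1)))"
      unfolding flip_energy_def by (intro sum.cong refl) (simp add: h_def power2_eq_square algebra_simps)
    also have "\<dots> = real m * (g j - g t)\<^sup>2 + flip_energy m (h j) (h t)"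
      using h_zero[of j] h_zero[of t] sum_periodic_shift[OF m0 h_per, of t 1]
      by (simp add: sum.distrib sum_subtractf sum_distrib_left[symmetric] flip_energy_def)
    finally show ?thesis .
  qed
  define S where "S = (\<Sum>i\<in>{1..p}. \<Sum>j\<in>{1..i}. (g j - g (i + 1 - j))\<^sup>2)"
  have "(real m)\<^sup>2 \<ge> 4" using power_mono[of 2 "real m" 2] m by simp
  moreover have "S \<ge> 0" unfolding S_def by (intro sum_nonneg) simp
  ultimately have "2 * S \<le> (real m)\<^sup>2 * S" by (intro mult_right_mono) auto
  then have "4 * (\<Sum>j\<in>{1..p}. (g j)\<^sup>2) \<le> (real m)\<^sup>2 * S" using pos unfolding S_def by linarith
  then have "real m * (4 * (\<Sum>j\<in>{1..p}. (g j)\<^sup>2)) \<le> real m * ((real m)\<^sup>2 * S)"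
    by (intro mult_left_mono) auto
  moreover note color_energy_bound[where h = h and p = p, OF m h_per h_zero]
  ultimately show ?thesis
    unfolding norm energy
    by (simp add: sum.distrib sum_distrib_left[symmetric] S_def algebra_simps)
qed

text \<open>
  Pairing the eigenvalue equation with \<open>G\<close> turns it into \<open>\<mu> |G|\<^sup>2 = E(G)\<close>. In each flip length the
  two color shifts contribute equally, because a move with shift \<open>1\<close> reverses a move with
  shift \<open>-1\<close>; thus the energy involves upward shifts only.
\<close>

lemma quotient_eigenfunction_vanishes:
  fixes G :: "nat \<Rightarrow> int \<Rightarrow> real"
  assumes m: "m \<ge> 2" and per: "\<And>j. periodic m (G j)"
    and zero: "(\<Sum>j\<in>{1..p}. \<Sum>c\<in>{0..<int m}. G j c) = 0"
    and eigen: "\<And>j c. j \<in> {1..p} \<Longrightarrow> (\<Sum>i\<in>{1..p}. if j \<le> i then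
        G j c - (G (i + 1 - j) (c + 1) + G (i + 1 - j) (c - 1)) / 2 else 0) = \<mu> * G j c"
    and small: "\<mu> < 2 / (real m)\<^sup>2"
    and j: "j \<in> {1..p}"
  shows "G j c = 0"
proof -
  let ?C = "{0..<int m}"
  have m0: "m > 0" using m by simp
  define N where "N = (\<Sum>j\<in>{1..p}. \<Sum>c\<in>?C. (G j c)\<^sup>2)"
  define X where "X i j c = G j c * (G j c - (G (i + 1 - j) (c + 1) + G (i + 1 - j) (c - 1)) / 2)" for i j c
  have "\<mu> * N = (\<Sum>j\<in>{1..p}. \<Sum>c\<in>?C. G j c * (\<mu> * G j c))"
    by (simp add: N_def sum_distrib_left power2_eq_square mult_ac)
  also have "\<dots> = (\<Sum>j\<in>{1..p}. \<Sum>c\<in>?C. \<Sum>i\<in>{1..p}. if j \<le> i then X i j c else 0)"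
    by (intro sum.cong refl) (simp add: eigen[symmetric] sum_distrib_left X_def if_distrib cong: if_cong)
  also have "\<dots> = (\<Sum>j\<in>{1..p}. \<Sum>i\<in>{1..p}. if j \<le> i then \<Sum>c\<in>?C. X i j c else 0)"
  proof (intro sum.cong refl)
    fix j
    have "(\<Sum>c\<in>?C. \<Sum>i\<in>{1..p}. if j \<le> i then X i j c else 0) =
        (\<Sum>i\<in>{1..p}. \<Sum>c\<in>?C. if j \<le> i then X i j c else 0)"
      by (rule sum.swap)
    also have "\<dots> = (\<Sum>i\<in>{1..p}. if j \<le> i then \<Sum>c\<in>?C. X i j c else 0)"
      by (intro sum.cong refl) simp
    finally show "(\<Sum>c\<in>?C. \<Sum>i\<in>{1..p}. if j \<le> i then X i j c else 0) =
        (\<Sum>i\<in>{1..p}. if j \<le> i then \<Sum>c\<in>?C. X i j c else 0)" .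
  qed
  also have "\<dots> = (\<Sum>i\<in>{1..p}. \<Sum>j\<in>{1..p}. if j \<le> i then \<Sum>c\<in>?C. X i j c else 0)"
    by (rule sum.swap)
  also have "\<dots> = (\<Sum>i\<in>{1..p}. \<Sum>j\<in>{1..i}. \<Sum>c\<in>?C. X i j c)"
    by (intro sum.cong[OF refl]) (auto simp flip: sum.inter_filter intro!: sum.cong)
  also have "\<dots> = (\<Sum>i\<in>{1..p}. \<Sum>j\<in>{1..i}. flip_energy m (G j) (G (i + 1 - j)) / 2)"
  proof (rule sum.cong[OF refl])
    fix i assume "i \<in> {1..p}"
    define W where "W j = (\<Sum>c\<in>?C. (G j c)\<^sup>2)" for j
    define U where "U j = (\<Sum>c\<in>?C. G j c * G (i + 1 - j) (c + 1))" for j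
    define V where "V j = (\<Sum>c\<in>?C. G j c * G (i + 1 - j) (c - 1))" for j
    have reflect: "(\<Sum>j\<in>{1..i}. f (i + 1 - j)) = (\<Sum>j\<in>{1..i}. f j)" for f :: "nat \<Rightarrow> real"
      by (rule sum.reindex_bij_witness[where i = "\<lambda>j. i + 1 - j" and j = "\<lambda>j. i + 1 - j"]) auto
    have "U j = V (i + 1 - j)" if "j \<in> {1..i}" for j
    proof -
      have "periodic m (\<lambda>c. G (i + 1 - j) c * G j (c - 1))"
        using per[of "i + 1 - j"] per[of j] unfolding periodic_def
        by (metis add_diff_eq add.commute diff_add_eq)
      from sum_periodic_shift[OF m0 this, of 1]
      show ?thesis using that by (simp add: U_def V_def mult.commute)
    qed
    then have UV: "(\<Sum>j\<in>{1..i}. U j) = (\<Sum>j\<in>{1..i}. V j)" using reflect[of V] by simp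
    have "(\<Sum>c\<in>?C. X i j c) = W j - (U j + V j) / 2" for j
      by (simp add: X_def W_def U_def V_def algebra_simps power2_eq_square sum.distrib sum_subtractf
          flip: sum_divide_distrib sum_distrib_left)
    then have "(\<Sum>j\<in>{1..i}. \<Sum>c\<in>?C. X i j c) = (\<Sum>j\<in>{1..i}. W j) - (\<Sum>j\<in>{1..i}. U j)"
      using UV by (simp add: sum_subtractf sum.distrib flip: sum_divide_distrib)
    moreover have "flip_energy m (G j) (G (i + 1 - j)) = W j + W (i + 1 - j) - 2 * U j" for j
    proof -
      have "periodic m (\<lambda>c. (G (i + 1 - j) c)\<^sup>2)" using per[of "i + 1 - j"] by (simp add: periodic_def)
      from sum_periodic_shift[OF m0 this, of 1]
      have "W (i + 1 - j) = (\<Sum>c\<in>?C. (G (i + 1 - j) (c + 1))\<^sup>2)" by (simp add: W_def)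
      moreover have "flip_energy m (G j) (G (i + 1 - j)) =
          (\<Sum>c\<in>?C. (G j c)\<^sup>2 + (G (i + 1 - j) (c + 1))\<^sup>2 - 2 * (G j c * G (i + 1 - j) (c + 1)))"
        unfolding flip_energy_def by (intro sum.cong) (simp_all add: power2_eq_square algebra_simps)
      ultimately show ?thesis
        by (simp add: W_def U_def sum.distrib sum_subtractf flip: sum_distrib_left)
    qed
    then have "(\<Sum>j\<in>{1..i}. flip_energy m (G j) (G (i + 1 - j)) / 2) =
        (\<Sum>j\<in>{1..i}. W j) - (\<Sum>j\<in>{1..i}. U j)"
      using reflect[of W] by (simp add: sum.distrib sum_subtractf flip: sum_divide_distrib sum_distrib_left)
    ultimately show "(\<Sum>j\<in>{1..i}. \<Sum>c\<in>?C. X i j c) =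
        (\<Sum>j\<in>{1..i}. flip_energy m (G j) (G (i + 1 - j)) / 2)" by simp
  qed
  finally have E: "\<mu> * N = (\<Sum>i\<in>{1..p}. \<Sum>j\<in>{1..i}. flip_energy m (G j) (G (i + 1 - j))) / 2"
    by (simp add: sum_divide_distrib)
  have "4 * N \<le> (real m)\<^sup>2 * (2 * (\<mu> * N))"
    using quotient_energy_bound[OF m per zero, folded N_def] unfolding E by simp
  then have "2 * N \<le> ((real m)\<^sup>2 * \<mu>) * N" by (simp add: mult_ac)
  moreover have "(real m)\<^sup>2 * \<mu> < 2" using small m by (simp add: field_simps)
  moreover have "N \<ge> 0" unfolding N_def by (intro sum_nonneg) simp
  ultimately have "N = 0"
  proof -
    have "(2 - (real m)\<^sup>2 * \<mu>) * N \<le> 0"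
      using \<open>2 * N \<le> ((real m)\<^sup>2 * \<mu>) * N\<close> by (simp add: left_diff_distrib)
    then have "N \<le> 0" using \<open>(real m)\<^sup>2 * \<mu> < 2\<close> by (simp add: mult_le_0_iff)
    then show ?thesis using \<open>N \<ge> 0\<close> by simp
  qed
  then have "(\<Sum>c\<in>?C. (G j c)\<^sup>2) = 0"
    using j unfolding N_def by (subst (asm) sum_nonneg_eq_0_iff) (auto intro: sum_nonneg)
  then have "(G j (c mod int m))\<^sup>2 = 0"
    using m0 by (subst (asm) sum_nonneg_eq_0_iff) auto
  then show ?thesis using periodic_cong_mod[OF per] by simp
qed

section \<open>Restricting to the flips of the top pancakes\<close>

text \<open>
  What the induction uses about colored permutations: a stack is determined by the labels and
  colors at its positions, and the flip \<open>s \<epsilon> i\<close> reverses the first \<open>i\<close> positions and adds \<open>\<epsilon>\<close> to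
  their colors.
\<close>

locale colored_stacks =
  fixes X :: "'x set" and n m :: nat
    and lab :: "nat \<Rightarrow> 'x \<Rightarrow> nat" and col :: "nat \<Rightarrow> 'x \<Rightarrow> int"
    and s :: "int \<Rightarrow> nat \<Rightarrow> 'x \<Rightarrow> 'x"
  assumes finite_X: "finite X" and m2: "m \<ge> 2"
    and flip_closed: "\<And>\<epsilon> i x. \<epsilon> \<in> {1, -1} \<Longrightarrow> i \<in> {1..n} \<Longrightarrow> x \<in> X \<Longrightarrow> s \<epsilon> i x \<in> X"
    and flip_inverse: "\<And>\<epsilon> i x. \<epsilon> \<in> {1, -1} \<Longrightarrow> i \<in> {1..n} \<Longrightarrow> x \<in> X \<Longrightarrow> s (- \<epsilon>) i (s \<epsilon> i x) = x"
    and lab_flip: "\<And>\<epsilon> i x j. \<epsilon> \<in> {1, -1} \<Longrightarrow> i \<in> {1..n} \<Longrightarrow> x \<in> X \<Longrightarrow> j \<in> {1..n} \<Longrightarrow>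
      lab j (s \<epsilon> i x) = lab (prefix_rev i j) x"
    and col_flip: "\<And>\<epsilon> i x j. \<epsilon> \<in> {1, -1} \<Longrightarrow> i \<in> {1..n} \<Longrightarrow> x \<in> X \<Longrightarrow> j \<in> {1..n} \<Longrightarrow>
      col j (s \<epsilon> i x) = (col (prefix_rev i j) x + (if j \<le> i then \<epsilon> else 0)) mod int m"
    and col_range: "\<And>x j. x \<in> X \<Longrightarrow> j \<in> {1..n} \<Longrightarrow> col j x \<in> {0..<int m}"
    and stack_eqI: "\<And>x y. x \<in> X \<Longrightarrow> y \<in> X \<Longrightarrow>
      (\<And>j. j \<in> {1..n} \<Longrightarrow> lab j x = lab j y \<and> col j x = col j y) \<Longrightarrow> x = y"
    and lab_bij: "\<And>x. x \<in> X \<Longrightarrow> bij_betw (\<lambda>j. lab j x) {1..n} {1..n}"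
begin

definition flip_laplacian :: "nat \<Rightarrow> ('x \<Rightarrow> real) \<Rightarrow> 'x \<Rightarrow> real" where
  "flip_laplacian i f x = f x - (f (s 1 i x) + f (s (-1) i x)) / 2"

definition partial_laplacian :: "nat \<Rightarrow> ('x \<Rightarrow> real) \<Rightarrow> 'x \<Rightarrow> real" where
  "partial_laplacian p f x = (\<Sum>i\<in>{1..p}. flip_laplacian i f x)"

definition laplacian_kernel :: "nat \<Rightarrow> 'x \<Rightarrow> 'x \<Rightarrow> real" where
  "laplacian_kernel p x y = (\<Sum>i\<in>{1..p}. of_bool (x = y) - (of_bool (s 1 i x = y) + of_bool (s (-1) i x = y)) / 2)"

text \<open>
  The orbit of \<open>x\<close> under the flips of length at most \<open>p\<close> lies in this set of stacks that agree
  with \<open>x\<close> in the positions after \<open>p\<close>.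
\<close>

definition block :: "nat \<Rightarrow> 'x \<Rightarrow> 'x set" where
  "block p x = {y \<in> X. \<forall>j\<in>{p<..n}. lab j y = lab j x \<and> col j y = col j x}"

lemma finite_block [simp]: "finite (block p x)"
  using finite_X by (simp add: block_def)

lemma block_subset: "block p x \<subseteq> X"
  by (auto simp: block_def)

lemma block_self: "x \<in> X \<Longrightarrow> x \<in> block p x"
  by (simp add: block_def)

lemma block_eq: "y \<in> block p x \<Longrightarrow> block p y = block p x"
  by (auto simp: block_def)

lemma block_sym: "x \<in> X \<Longrightarrow> y \<in> X \<Longrightarrow> y \<in> block p x \<longleftrightarrow> x \<in> block p y"
  by (auto simp: block_def)

lemma block_0: "x \<in> X \<Longrightarrow> block 0 x = {x}"
  by (auto simp: block_def intro: stack_eqI)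

lemma block_all: "block n x = X"
  by (auto simp: block_def)

lemma flip_in_block:
  assumes "\<epsilon> \<in> {1, -1}" "i \<in> {1..p}" "p \<le> n" "y \<in> block p x"
  shows "s \<epsilon> i y \<in> block p x"
proof -
  have y: "y \<in> X" using assms(4) by (simp add: block_def)
  have i: "i \<in> {1..n}" using assms by auto
  have "lab j (s \<epsilon> i y) = lab j y" "col j (s \<epsilon> i y) = col j y" if "j \<in> {p<..n}" for j
  proof -
    have "j \<in> {1..n}" "prefix_rev i j = j" "\<not> j \<le> i" using that assms(2) by (auto simp: prefix_rev_def)
    then show "lab j (s \<epsilon> i y) = lab j y" "col j (s \<epsilon> i y) = col j y"
      using lab_flip[OF assms(1) i y] col_flip[OF assms(1) i y] col_range[OF y, of j] by auto
  qed
  then show ?thesis using assms(4) flip_closed[OF assms(1) i y] by (simp add: block_def)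
qed

lemma sum_block_flip:
  assumes \<epsilon>: "\<epsilon> \<in> {1, -1}" and "i \<in> {1..p}" "p \<le> n"
  shows "(\<Sum>y\<in>block p x. f (s \<epsilon> i y)) = (\<Sum>y\<in>block p x. f y)"
proof (rule sum.reindex_bij_witness[where i = "s (- \<epsilon>) i" and j = "s \<epsilon> i"])
  have i: "i \<in> {1..n}" and \<epsilon>': "- \<epsilon> \<in> {1, -1}" using assms by auto
  fix y assume y: "y \<in> block p x"
  then have "y \<in> X" by (simp add: block_def)
  then show "s (- \<epsilon>) i (s \<epsilon> i y) = y" "s \<epsilon> i (s (- \<epsilon>) i y) = y"
    using flip_inverse[OF \<epsilon> i] flip_inverse[OF \<epsilon>' i] by auto
  show "s \<epsilon> i y \<in> block p x" "s (- \<epsilon>) i y \<in> block p x"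
    using flip_in_block[OF \<epsilon> _ _ y] flip_in_block[OF \<epsilon>' _ _ y] assms by auto
qed simp

lemma sum_flip:
  assumes "\<epsilon> \<in> {1, -1}" "i \<in> {1..n}"
  shows "(\<Sum>y\<in>X. f (s \<epsilon> i y)) = (\<Sum>y\<in>X. f y)"
  using sum_block_flip[OF assms order_refl] by (simp add: block_all)

lemma flip_laplacian_nonneg:
  assumes i: "i \<in> {1..n}"
  shows "0 \<le> (\<Sum>x\<in>X. f x * flip_laplacian i f x)"
proof -
  have sq: "(\<Sum>x\<in>X. (f (s 1 i x))\<^sup>2) = (\<Sum>x\<in>X. (f x)\<^sup>2)"
    using sum_flip[of 1 i "\<lambda>x. (f x)\<^sup>2"] i by simp
  have "(\<Sum>x\<in>X. f x * f (s (-1) i x)) = (\<Sum>x\<in>X. f (s 1 i x) * f (s (-1) i (s 1 i x)))"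
    using sum_flip[of 1 i "\<lambda>x. f x * f (s (-1) i x)"] i by simp
  also have "\<dots> = (\<Sum>x\<in>X. f x * f (s 1 i x))"
    using flip_inverse[of 1 i] i by (intro sum.cong refl) (simp add: mult.commute)
  finally have cross: "(\<Sum>x\<in>X. f x * f (s (-1) i x)) = (\<Sum>x\<in>X. f x * f (s 1 i x))" .
  have "(\<Sum>x\<in>X. f x * flip_laplacian i f x) =
      (\<Sum>x\<in>X. (f x)\<^sup>2) - ((\<Sum>x\<in>X. f x * f (s 1 i x)) + (\<Sum>x\<in>X. f x * f (s (-1) i x))) / 2"
    by (simp add: flip_laplacian_def algebra_simps power2_eq_square sum.distrib sum_subtractf
        flip: sum_divide_distrib)
  also have "\<dots> = ((\<Sum>x\<in>X. (f x)\<^sup>2) + (\<Sum>x\<in>X. (f (s 1 i x))\<^sup>2) - 2 * (\<Sum>x\<in>X. f x * f (s 1 i x))) / 2"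
    unfolding sq cross by simp
  also have "\<dots> = (\<Sum>x\<in>X. (f x - f (s 1 i x))\<^sup>2) / 2"
    by (simp add: power2_diff sum.distrib sum_subtractf sum_distrib_left mult.assoc)
  also have "\<dots> \<ge> 0" by (simp add: sum_nonneg)
  finally show ?thesis .
qed

lemma laplacian_kernel_apply:
  assumes "p \<le> n" "x \<in> X"
  shows "(\<Sum>y\<in>X. laplacian_kernel p x y * f y) = partial_laplacian p f x"
proof -
  have delta: "(\<Sum>y\<in>X. of_bool (z = y) * f y) = f z" if "z \<in> X" for z
    using that finite_X by (simp add: of_bool_def if_distrib[of "\<lambda>a. a * _"] cong: if_cong)
  have "(\<Sum>y\<in>X. laplacian_kernel p x y * f y) = (\<Sum>i\<in>{1..p}. \<Sum>y\<in>X. of_bool (x = y) * f y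
      - (of_bool (s 1 i x = y) * f y + of_bool (s (-1) i x = y) * f y) / 2)"
    unfolding laplacian_kernel_def sum_distrib_right by (subst sum.swap) (simp add: algebra_simps)
  also have "\<dots> = partial_laplacian p f x"
    unfolding partial_laplacian_def flip_laplacian_def
  proof (rule sum.cong[OF refl])
    fix i assume "i \<in> {1..p}"
    then have "s 1 i x \<in> X" "s (-1) i x \<in> X" using assms flip_closed[of _ i x] by auto
    then show "(\<Sum>y\<in>X. of_bool (x = y) * f y - (of_bool (s 1 i x = y) * f y + of_bool (s (-1) i x = y) * f y) / 2)
        = f x - (f (s 1 i x) + f (s (-1) i x)) / 2"
      using delta assms(2) by (simp add: sum_subtractf sum.distrib flip: sum_divide_distrib)
  qed
  finally show ?thesis .
qed

lemma laplacian_kernel_sym: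
  assumes "p \<le> n" "x \<in> X" "y \<in> X"
  shows "laplacian_kernel p x y = laplacian_kernel p y x"
  unfolding laplacian_kernel_def
proof (rule sum.cong[OF refl])
  fix i assume "i \<in> {1..p}"
  then have i: "i \<in> {1..n}" using assms(1) by auto
  have "s 1 i x = y \<longleftrightarrow> s (-1) i y = x" "s 1 i y = x \<longleftrightarrow> s (-1) i x = y"
    using flip_inverse[of 1 i] flip_inverse[of "-1" i] i assms(2,3) by auto
  then show "of_bool (x = y) - (of_bool (s 1 i x = y) + of_bool (s (-1) i x = y)) / 2 =
      (of_bool (y = x) - (of_bool (s 1 i y = x) + of_bool (s (-1) i y = x)) / 2 :: real)"
    by (auto simp: of_bool_def)
qed

lemma sum_block_partial_laplacian:
  assumes "p \<le> n"
  shows "(\<Sum>y\<in>block p x. partial_laplacian p f y) = 0"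
proof -
  have "(\<Sum>y\<in>block p x. flip_laplacian i f y) = 0" if "i \<in> {1..p}" for i
    using sum_block_flip[OF _ that assms, of 1 f x] sum_block_flip[OF _ that assms, of "-1" f x]
    by (simp add: flip_laplacian_def sum_subtractf sum.distrib flip: sum_divide_distrib)
  then show ?thesis unfolding partial_laplacian_def by (subst sum.swap) simp
qed

text \<open>
  The sum of \<open>q\<close> over the stacks of a block in which the pancake with label \<open>k\<close> has position \<open>j\<close>
  and color \<open>c\<close>. This projects functions on stacks to functions on the states of one pancake.
\<close>

definition marked_sum :: "nat \<Rightarrow> 'x \<Rightarrow> ('x \<Rightarrow> real) \<Rightarrow> nat \<Rightarrow> nat \<Rightarrow> int \<Rightarrow> real" where
  "marked_sum p x q k j c = (\<Sum>y\<in>block p x. of_bool (lab j y = k \<and> col j y = c mod int m) * q y)"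

lemma periodic_marked_sum: "periodic m (marked_sum p x q k j)"
  by (simp add: periodic_def marked_sum_def)

text \<open>
  Substituting the inverse flip: the marked pancake is at \<open>j\<close> with color \<open>c\<close> after the inverse flip
  exactly if before it was at the reflected position with the color shifted back.
\<close>

lemma marked_sum_flip:
  assumes \<epsilon>: "\<epsilon> \<in> {1, -1}" and i: "i \<in> {1..p}" and p: "p \<le> n" and j: "j \<in> {1..p}"
  shows "(\<Sum>y\<in>block p x. of_bool (lab j y = k \<and> col j y = c mod int m) * q (s \<epsilon> i y)) =
    marked_sum p x q k (prefix_rev i j) (c + (if j \<le> i then \<epsilon> else 0))"
proof -
  have \<epsilon>': "- \<epsilon> \<in> {1, -1}" and i': "i \<in> {1..n}" and j': "j \<in> {1..n}" using assms by auto
  let ?a = "if j \<le> i then \<epsilon> else 0"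
  have "(\<Sum>y\<in>block p x. of_bool (lab j y = k \<and> col j y = c mod int m) * q (s \<epsilon> i y)) =
      (\<Sum>y\<in>block p x. of_bool (lab j (s (- \<epsilon>) i y) = k \<and> col j (s (- \<epsilon>) i y) = c mod int m) *
        q (s \<epsilon> i (s (- \<epsilon>) i y)))"
    by (rule sum_block_flip[OF \<epsilon>' i p, symmetric])
  also have "\<dots> = marked_sum p x q k (prefix_rev i j) (c + ?a)"
    unfolding marked_sum_def
  proof (rule sum.cong[OF refl])
    fix y assume "y \<in> block p x"
    then have y: "y \<in> X" by (simp add: block_def)
    have "prefix_rev i j \<in> {1..n}" using i' j' by (auto simp: prefix_rev_def)
    then have r: "col (prefix_rev i j) y \<in> {0..<int m}" by (rule col_range[OF y])
    have "(col (prefix_rev i j) y - ?a) mod int m = c mod int m \<longleftrightarrow> col (prefix_rev i j) y = (c + ?a) mod int m"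
    proof
      assume "(col (prefix_rev i j) y - ?a) mod int m = c mod int m"
      then have "(col (prefix_rev i j) y - ?a + ?a) mod int m = (c + ?a) mod int m" by (metis mod_add_left_eq)
      then show "col (prefix_rev i j) y = (c + ?a) mod int m" using r by simp
    next
      assume "col (prefix_rev i j) y = (c + ?a) mod int m"
      then show "(col (prefix_rev i j) y - ?a) mod int m = c mod int m" by (simp add: mod_diff_left_eq)
    qed
    moreover have "col j (s (- \<epsilon>) i y) = (col (prefix_rev i j) y - ?a) mod int m"
      using col_flip[OF \<epsilon>' i' y j'] by auto
    moreover have "s \<epsilon> i (s (- \<epsilon>) i y) = y" using flip_inverse[OF \<epsilon>' i' y] by simp
    ultimately show "of_bool (lab j (s (- \<epsilon>) i y) = k \<and> col j (s (- \<epsilon>) i y) = c mod int m) *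
        q (s \<epsilon> i (s (- \<epsilon>) i y)) =
        of_bool (lab (prefix_rev i j) y = k \<and> col (prefix_rev i j) y = (c + ?a) mod int m) * q y"
      using lab_flip[OF \<epsilon>' i' y j'] by simp
  qed
  finally show ?thesis .
qed

lemma marked_sum_eigen:
  assumes p: "p \<le> n" and j: "j \<in> {1..p}"
    and eigen: "\<And>y. y \<in> X \<Longrightarrow> partial_laplacian p q y = \<mu> * q y"
  shows "(\<Sum>i\<in>{1..p}. if j \<le> i then marked_sum p x q k j c - (marked_sum p x q k (i + 1 - j) (c + 1)
      + marked_sum p x q k (i + 1 - j) (c - 1)) / 2 else 0) = \<mu> * marked_sum p x q k j c"
proof -
  let ?I = "\<lambda>y. of_bool (lab j y = k \<and> col j y = c mod int m) :: real"
  have "\<mu> * marked_sum p x q k j c = (\<Sum>y\<in>block p x. ?I y * partial_laplacian p q y)"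
    unfolding marked_sum_def sum_distrib_left
  proof (rule sum.cong[OF refl])
    fix y assume "y \<in> block p x"
    then have "y \<in> X" by (simp add: block_def)
    then show "\<mu> * (?I y * q y) = ?I y * partial_laplacian p q y" by (simp add: eigen)
  qed
  also have "\<dots> = (\<Sum>i\<in>{1..p}. \<Sum>y\<in>block p x. ?I y * flip_laplacian i q y)"
    unfolding partial_laplacian_def sum_distrib_left by (rule sum.swap)
  also have "\<dots> = (\<Sum>i\<in>{1..p}. if j \<le> i then marked_sum p x q k j c - (marked_sum p x q k (i + 1 - j) (c + 1)
      + marked_sum p x q k (i + 1 - j) (c - 1)) / 2 else 0)"
  proof (rule sum.cong[OF refl])
    fix i assume i: "i \<in> {1..p}"
    have "(\<Sum>y\<in>block p x. ?I y * flip_laplacian i q y) = marked_sum p x q k j c -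
        ((\<Sum>y\<in>block p x. ?I y * q (s 1 i y)) + (\<Sum>y\<in>block p x. ?I y * q (s (-1) i y))) / 2"
      unfolding flip_laplacian_def marked_sum_def
      by (simp add: right_diff_distrib distrib_left sum_subtractf sum.distrib flip: sum_divide_distrib times_divide_eq_right)
    also have "\<dots> = (if j \<le> i then marked_sum p x q k j c - (marked_sum p x q k (i + 1 - j) (c + 1)
        + marked_sum p x q k (i + 1 - j) (c - 1)) / 2 else 0)"
      using marked_sum_flip[OF _ i p j, where \<epsilon> = 1 and x = x and k = k and c = c and q = q]
        marked_sum_flip[OF _ i p j, where \<epsilon> = "-1" and x = x and k = k and c = c and q = q] j
      by (auto simp: prefix_rev_def)
    finally show "(\<Sum>y\<in>block p x. ?I y * flip_laplacian i q y) = (if j \<le> i then marked_sum p x q k j c -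
        (marked_sum p x q k (i + 1 - j) (c + 1) + marked_sum p x q k (i + 1 - j) (c - 1)) / 2 else 0)" .
  qed
  finally show ?thesis by simp
qed

text \<open>
  The label \<open>lab p x\<close> is absent from the positions after \<open>p\<close> of \<open>x\<close>, which all stacks of the block
  share, so each stack of the block carries it exactly once among the first \<open>p\<close> positions.
\<close>

lemma marked_sum_total:
  assumes p: "p \<le> n" "1 \<le> p" and x: "x \<in> X"
  shows "(\<Sum>j\<in>{1..p}. \<Sum>c\<in>{0..<int m}. marked_sum p x q (lab p x) j c) = (\<Sum>y\<in>block p x. q y)"
proof -
  let ?C = "{0..<int m}" and ?k = "lab p x"
  have once: "(\<Sum>j\<in>{1..p}. \<Sum>c\<in>?C. of_bool (lab j y = ?k \<and> col j y = c mod int m)) = (1::real)"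
    if y: "y \<in> block p x" for y
  proof -
    have yX: "y \<in> X" using y by (simp add: block_def)
    have k: "?k \<in> {1..n}" using lab_bij[OF x] p by (auto simp: bij_betw_def)
    then have "?k \<in> (\<lambda>j. lab j y) ` {1..n}" using lab_bij[OF yX] by (simp add: bij_betw_def)
    then obtain l where l: "l \<in> {1..n}" "lab l y = ?k" by auto
    have uniq: "j = l" if "j \<in> {1..n}" "lab j y = ?k" for j
      using that l lab_bij[OF yX] unfolding bij_betw_def inj_on_def by metis
    have "l \<le> p"
    proof (rule ccontr)
      assume "\<not> l \<le> p"
      then have "lab l x = ?k" using y l by (auto simp: block_def)
      then have "l = p" using lab_bij[OF x] l(1) p unfolding bij_betw_def inj_on_def by (metis atLeastAtMost_iff)
      then show False using \<open>\<not> l \<le> p\<close> by simp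
    qed
    have one: "(\<Sum>c\<in>?C. of_bool (col l y = c mod int m)) = (1::real)"
    proof -
      have "(\<Sum>c\<in>?C. of_bool (col l y = c mod int m)) = (\<Sum>c\<in>?C. if c = col l y then 1 else (0::real))"
        by (intro sum.cong refl) auto
      then show ?thesis using col_range[OF yX l(1)] by simp
    qed
    have "(\<Sum>j\<in>{1..p}. \<Sum>c\<in>?C. of_bool (lab j y = ?k \<and> col j y = c mod int m)) =
        (\<Sum>j\<in>{1..p}. if j = l then \<Sum>c\<in>?C. of_bool (col l y = c mod int m) else (0::real))"
    proof (rule sum.cong[OF refl])
      fix j assume "j \<in> {1..p}"
      then have "lab j y = ?k \<longleftrightarrow> j = l" using l(2) uniq[of j] p by auto
      then show "(\<Sum>c\<in>?C. of_bool (lab j y = ?k \<and> col j y = c mod int m)) =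
          (if j = l then \<Sum>c\<in>?C. of_bool (col l y = c mod int m) else (0::real))" by simp
    qed
    then show ?thesis using one l(1) \<open>l \<le> p\<close> by simp
  qed
  have "(\<Sum>j\<in>{1..p}. \<Sum>c\<in>?C. marked_sum p x q ?k j c) = (\<Sum>y\<in>block p x.
      (\<Sum>j\<in>{1..p}. \<Sum>c\<in>?C. of_bool (lab j y = ?k \<and> col j y = c mod int m)) * q y)"
  proof -
    have "(\<Sum>j\<in>{1..p}. \<Sum>c\<in>?C. marked_sum p x q ?k j c) = (\<Sum>j\<in>{1..p}. \<Sum>y\<in>block p x.
        (\<Sum>c\<in>?C. of_bool (lab j y = ?k \<and> col j y = c mod int m)) * q y)"
      unfolding marked_sum_def sum_distrib_right by (rule sum.cong[OF refl], rule sum.swap)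
    also have "\<dots> = (\<Sum>y\<in>block p x. \<Sum>j\<in>{1..p}.
        (\<Sum>c\<in>?C. of_bool (lab j y = ?k \<and> col j y = c mod int m)) * q y)" by (rule sum.swap)
    finally show ?thesis by (simp only: sum_distrib_right)
  qed
  also have "\<dots> = (\<Sum>y\<in>block p x. q y)" using once by (intro sum.cong refl) simp
  finally show ?thesis .
qed

text \<open>
  Fixing also the label and the color at the last free position describes a block one size smaller.
\<close>

lemma marked_sum_last:
  assumes p: "Suc p \<le> n" and x: "x \<in> X"
  shows "marked_sum (Suc p) x q (lab (Suc p) x) (Suc p) (col (Suc p) x) = (\<Sum>y\<in>block p x. q y)"
proof -
  have "col (Suc p) x mod int m = col (Suc p) x" using col_range[OF x, of "Suc p"] p by simp
  moreover have "block p x = {y \<in> block (Suc p) x. lab (Suc p) y = lab (Suc p) x \<and> col (Suc p) y = col (Suc p) x}"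
  proof -
    have "{p<..n} = insert (Suc p) {Suc p<..n}" using p by auto
    then show ?thesis by (auto simp: block_def)
  qed
  ultimately show ?thesis
    by (simp add: marked_sum_def sum.inter_filter of_bool_def if_distrib[of "\<lambda>a. a * _"] cong: if_cong)
qed

definition block_average :: "nat \<Rightarrow> ('x \<Rightarrow> real) \<Rightarrow> 'x \<Rightarrow> real" where
  "block_average p q x = (\<Sum>y\<in>block p x. q y) / real (card (block p x))"

lemma card_block_pos: "x \<in> X \<Longrightarrow> card (block p x) > 0"
  using block_self by (auto simp: card_gt_0_iff)

lemma block_average_const: "y \<in> block p x \<Longrightarrow> block_average p q y = block_average p q x"
  by (simp add: block_average_def block_eq)

lemma sum_block_average:
  assumes "x \<in> X"
  shows "(\<Sum>y\<in>block p x. block_average p q y) = (\<Sum>y\<in>block p x. q y)"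
proof -
  have "(\<Sum>y\<in>block p x. block_average p q y) = (\<Sum>y\<in>block p x. block_average p q x)"
    by (intro sum.cong refl block_average_const)
  then show ?thesis using card_block_pos[OF assms, of p] by (simp add: block_average_def)
qed

text \<open>
  Since block averages are constant on blocks, pairing with them only sees the block sums of \<open>f\<close>.
\<close>

lemma sum_block_average_orthogonal:
  assumes zero: "\<And>x. x \<in> X \<Longrightarrow> (\<Sum>y\<in>block p x. f y) = 0"
  shows "(\<Sum>x\<in>X. f x * block_average p q x) = 0"
proof -
  have "(\<Sum>x\<in>X. f x * block_average p q x) =
      (\<Sum>x\<in>X. \<Sum>y\<in>X. if y \<in> block p x then f x * q y / real (card (block p x)) else 0)"
  proof (rule sum.cong[OF refl])
    fix x
    have "(\<Sum>y\<in>X. if y \<in> block p x then f x * q y / real (card (block p x)) else 0) =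
        (\<Sum>y\<in>block p x. f x * q y / real (card (block p x)))"
      using block_subset[of p x] finite_X by (simp add: sum.If_cases Int_absorb1)
    then show "f x * block_average p q x =
        (\<Sum>y\<in>X. if y \<in> block p x then f x * q y / real (card (block p x)) else 0)"
      by (simp add: block_average_def sum_distrib_left flip: sum_divide_distrib)
  qed
  also have "\<dots> = (\<Sum>y\<in>X. \<Sum>x\<in>X. if y \<in> block p x then f x * q y / real (card (block p x)) else 0)"
    by (rule sum.swap)
  also have "\<dots> = (\<Sum>y\<in>X. q y / real (card (block p y)) * (\<Sum>x\<in>block p y. f x))"
  proof (rule sum.cong[OF refl])
    fix y assume y: "y \<in> X"
    have "(\<Sum>x\<in>X. if y \<in> block p x then f x * q y / real (card (block p x)) else 0) =
        (\<Sum>x\<in>X. if x \<in> block p y then q y / real (card (block p y)) * f x else 0)"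
      using y by (intro sum.cong refl) (auto simp: block_sym block_eq)
    also have "\<dots> = (\<Sum>x\<in>block p y. q y / real (card (block p y)) * f x)"
      using block_subset[of p y] finite_X by (simp add: sum.If_cases Int_absorb1)
    finally show "(\<Sum>x\<in>X. if y \<in> block p x then f x * q y / real (card (block p x)) else 0) =
        q y / real (card (block p y)) * (\<Sum>x\<in>block p y. f x)" by (simp add: sum_distrib_left)
  qed
  also have "\<dots> = 0" by (simp add: zero)
  finally show ?thesis .
qed

text \<open>
  Flips of length at most \<open>p\<close> preserve the blocks, so the Laplacian kills block averages.
\<close>

lemma partial_laplacian_diff_average:
  assumes p: "p \<le> n" and x: "x \<in> X"
  shows "partial_laplacian p (\<lambda>y. q y - block_average p q y) x = partial_laplacian p q x"
  unfolding partial_laplacian_def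
proof (rule sum.cong[OF refl])
  fix i assume i: "i \<in> {1..p}"
  have "block_average p q (s \<epsilon> i x) = block_average p q x" if "\<epsilon> \<in> {1, -1}" for \<epsilon>
    using flip_in_block[OF that i p block_self[OF x]] by (rule block_average_const)
  then show "flip_laplacian i (\<lambda>y. q y - block_average p q y) x = flip_laplacian i q x"
    by (simp add: flip_laplacian_def field_simps)
qed

text \<open>
  In the step, \<open>vanish\<close> excludes eigenvalues below the bound among functions with zero block sums.
  An arbitrary such \<open>f\<close> is expanded in eigenfunctions \<open>q k\<close> on the whole set. If \<open>q k\<close> has a small
  eigenvalue, \<open>vanish\<close> applied to \<open>q k\<close> minus its block average shows that \<open>q k\<close> is constant on
  blocks and therefore orthogonal to \<open>f\<close>.
\<close>

lemma block_gap:
  assumes "p \<le> n" and "\<And>x. x \<in> X \<Longrightarrow> (\<Sum>y\<in>block p x. f y) = 0"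
  shows "2 / (real m)\<^sup>2 * (\<Sum>x\<in>X. (f x)\<^sup>2) \<le> (\<Sum>x\<in>X. f x * partial_laplacian p f x)"
  using assms
proof (induction p arbitrary: f)
  case 0
  then show ?case by (simp add: block_0)
next
  case (Suc r)
  let ?p = "Suc r" and ?lam = "2 / (real m)\<^sup>2"
  have p: "?p \<le> n" by (rule Suc.prems)
  have vanish: "q x = 0"
    if eigen: "\<And>y. y \<in> X \<Longrightarrow> partial_laplacian ?p q y = \<mu> * q y" and small: "\<mu> < ?lam"
      and zero: "\<And>y. y \<in> X \<Longrightarrow> (\<Sum>z\<in>block ?p y. q z) = 0" and x: "x \<in> X" for q \<mu> x
  proof -
    have "(\<Sum>z\<in>block r y. q z) = 0" if y: "y \<in> X" for y
    proof -
      let ?G = "marked_sum ?p y q (lab ?p y)"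
      have "?G ?p (col ?p y) = 0"
      proof (rule quotient_eigenfunction_vanishes[OF m2 periodic_marked_sum _ marked_sum_eigen[OF p _ eigen] small])
        show "(\<Sum>j\<in>{1..?p}. \<Sum>c\<in>{0..<int m}. ?G j c) = 0"
          using marked_sum_total[OF p _ y, of q] zero[OF y] by simp
      qed auto
      then show ?thesis using marked_sum_last[OF p y, of q] by simp
    qed
    then have "?lam * (\<Sum>x\<in>X. (q x)\<^sup>2) \<le> (\<Sum>x\<in>X. q x * partial_laplacian r q x)"
      using Suc.IH[of q] p by simp
    also have "\<dots> \<le> (\<Sum>x\<in>X. q x * partial_laplacian r q x) + (\<Sum>x\<in>X. q x * flip_laplacian ?p q x)"
      using flip_laplacian_nonneg[of ?p q] p by simp
    also have "\<dots> = (\<Sum>x\<in>X. q x * partial_laplacian ?p q x)"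
      by (simp add: partial_laplacian_def distrib_left sum.distrib)
    also have "\<dots> = \<mu> * (\<Sum>x\<in>X. (q x)\<^sup>2)"
      using eigen by (simp add: sum_distrib_left power2_eq_square mult_ac)
    finally have "(?lam - \<mu>) * (\<Sum>x\<in>X. (q x)\<^sup>2) \<le> 0" by (simp add: left_diff_distrib)
    then have "(\<Sum>x\<in>X. (q x)\<^sup>2) \<le> 0" using small by (simp add: mult_le_0_iff)
    then have "(\<Sum>x\<in>X. (q x)\<^sup>2) = 0" by (intro antisym sum_nonneg) auto
    then show ?thesis using x finite_X by (simp add: sum_nonneg_eq_0_iff)
  qed
  obtain vs where vs: "distinct vs" "set vs = X" using finite_distinct_list[OF finite_X] by blast
  obtain q d where "symmetric_kernel_eigenbasis X (laplacian_kernel ?p) (length vs) q d"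
    using symmetric_kernel_has_eigenbasis[where K = "laplacian_kernel ?p", OF vs] laplacian_kernel_sym[OF p]
    by metis
  then interpret symmetric_kernel_eigenbasis X "laplacian_kernel ?p" "length vs" q d .
  have "?lam * (coef f k)\<^sup>2 \<le> d k * (coef f k)\<^sup>2" if k: "k < length vs" for k
  proof (cases "d k < ?lam")
    case True
    define v where "v y = q k y - block_average ?p (q k) y" for y
    have eig: "partial_laplacian ?p (q k) y = d k * q k y" if "y \<in> X" for y
      using eigen[OF k that] laplacian_kernel_apply[OF p that] by simp
    have v_zero: "(\<Sum>z\<in>block ?p y. v z) = 0" if "y \<in> X" for y
      using sum_block_average[OF that] by (simp add: v_def sum_subtractf)
    have "partial_laplacian ?p v y = d k * v y" if y: "y \<in> X" for y
    proof -
      \<comment> \<open>Either the eigenvalue or the block average is zero, as Laplacians sum to zero over blocks.\<close>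
      have "d k * (\<Sum>z\<in>block ?p y. q k z) = (\<Sum>z\<in>block ?p y. partial_laplacian ?p (q k) z)"
        using block_subset[of ?p y] by (auto simp: eig sum_distrib_left intro!: sum.cong)
      then have "d k * (\<Sum>z\<in>block ?p y. q k z) = 0"
        using sum_block_partial_laplacian[OF p] by simp
      then have "d k * block_average ?p (q k) y = 0" by (simp add: block_average_def)
      then show ?thesis
        using partial_laplacian_diff_average[OF p y, of "q k"] eig[OF y]
        by (simp add: v_def[abs_def] right_diff_distrib)
    qed
    then have "v y = 0" if "y \<in> X" for y using vanish[OF _ True v_zero that] by simp
    then have "coef f k = (\<Sum>x\<in>X. f x * block_average ?p (q k) x)"
      unfolding coef_def by (intro sum.cong refl) (simp add: v_def)
    then show ?thesis using sum_block_average_orthogonal[OF Suc.prems(2), of "q k"] by simp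
  next
    case False
    then show ?thesis by (intro mult_right_mono) auto
  qed
  then have "(\<Sum>k<length vs. ?lam * (coef f k)\<^sup>2) \<le> (\<Sum>k<length vs. d k * (coef f k)\<^sup>2)"
    by (intro sum_mono) simp
  moreover have "(\<Sum>k<length vs. ?lam * (coef f k)\<^sup>2) = ?lam * (\<Sum>x\<in>X. (f x)\<^sup>2)"
    using parseval[of f f] by (simp add: power2_eq_square sum_distrib_left)
  moreover have "(\<Sum>k<length vs. d k * (coef f k)\<^sup>2) = (\<Sum>x\<in>X. f x * partial_laplacian ?p f x)"
    using form_expansion[of f] laplacian_kernel_apply[OF p] by simp
  ultimately show ?case by simp
qed

end

section \<open>The pancake graph\<close>

text \<open>
  The entries of the normalized Laplacian indexed by vertices, so that they do not depend on the
  enumeration of the vertices that is chosen to form a matrix.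
\<close>

definition laplacian_entry :: "'a pair_pre_digraph \<Rightarrow> 'a \<Rightarrow> 'a \<Rightarrow> real" where
  "laplacian_entry G x y = of_bool (x = y) - of_bool ((x, y) \<in> parcs G) / real (regular_degree G)"

lemma spectral_gap_eigenvalue:
  assumes fin: "finite (pverts G)" and card: "card (pverts G) \<ge> 2"
    and sym: "\<And>x y. x \<in> pverts G \<Longrightarrow> y \<in> pverts G \<Longrightarrow> laplacian_entry G x y = laplacian_entry G y x"
  obtains N q d i j where "symmetric_kernel_eigenbasis (pverts G) (laplacian_entry G) N q d"
    "i < N" "j < N" "i \<noteq> j" "d i \<le> d j" "\<And>k. k < N \<Longrightarrow> k \<noteq> i \<Longrightarrow> d j \<le> d k"
    "spectral_gap G = d j"
proof -
  define vs where "vs = (SOME vs. distinct vs \<and> set vs = pverts G)"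
  have "\<exists>vs. distinct vs \<and> set vs = pverts G" using finite_distinct_list[OF fin] by blast
  then have "distinct vs \<and> set vs = pverts G" unfolding vs_def by (rule someI_ex)
  then have vs: "distinct vs" "set vs = pverts G" by auto
  have len: "length vs \<ge> 2" using card vs by (metis distinct_card)
  obtain q d where basis: "symmetric_kernel_eigenbasis (pverts G) (laplacian_entry G) (length vs) q d"
    and cp: "char_poly (mat (length vs) (length vs) (\<lambda>(i, j). laplacian_entry G (vs ! i) (vs ! j))) =
      (\<Prod>k<length vs. [:- d k, 1:])"
    using symmetric_kernel_has_eigenbasis[where K = "laplacian_entry G", OF vs] sym by metis
  have "normalized_laplacian G vs = mat (length vs) (length vs) (\<lambda>(i, j). laplacian_entry G (vs ! i) (vs ! j))"
    unfolding normalized_laplacian_def adjacency_matrix_def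
    by (intro eq_matI) (auto simp: laplacian_entry_def nth_eq_iff_index_eq[OF vs(1)])
  then have spec: "spectral_gap G = sorted_list_of_multiset (mset (map d [0..<length vs])) ! 1"
    unfolding spectral_gap_def laplacian_spectrum_def vs_def[symmetric] by (simp only: cp proots_prod_linear)
  obtain i j where "i < length vs" "j < length vs" "i \<noteq> j" "d i \<le> d j"
      "\<And>k. k < length vs \<Longrightarrow> k \<noteq> i \<Longrightarrow> d j \<le> d k"
      "sorted_list_of_multiset (mset (map d [0..<length vs])) ! 1 = d j"
    using second_smallest_index[OF len, of d] by metis
  with basis spec show ?thesis by (intro that[of "length vs" q d i j]) auto
qed

lemma spectral_gap_ge:
  assumes "finite (pverts G)" and "card (pverts G) \<ge> 2"
    and "\<And>x y. x \<in> pverts G \<Longrightarrow> y \<in> pverts G \<Longrightarrow> laplacian_entry G x y = laplacian_entry G y x"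
    and gap: "\<And>f. (\<Sum>x\<in>pverts G. f x) = 0 \<Longrightarrow> lam * (\<Sum>x\<in>pverts G. (f x)\<^sup>2) \<le>
      (\<Sum>x\<in>pverts G. f x * (\<Sum>y\<in>pverts G. laplacian_entry G x y * f y))"
  shows "lam \<le> spectral_gap G"
proof -
  obtain N q d i j where b: "symmetric_kernel_eigenbasis (pverts G) (laplacian_entry G) N q d"
    "i < N" "j < N" "i \<noteq> j" "d i \<le> d j" "spectral_gap G = d j"
    using spectral_gap_eigenvalue[OF assms(1-3)] by metis
  show ?thesis
    unfolding b(6) by (rule symmetric_kernel_eigenbasis.second_eigenvalue_ge[OF b(1-5) gap])
qed

lemma spectral_gap_le:
  assumes "finite (pverts G)" and "card (pverts G) \<ge> 2"
    and "\<And>x y. x \<in> pverts G \<Longrightarrow> y \<in> pverts G \<Longrightarrow> laplacian_entry G x y = laplacian_entry G y x"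
    and "\<And>x. x \<in> pverts G \<Longrightarrow> (\<Sum>y\<in>pverts G. laplacian_entry G x y) = 0"
    and "(\<Sum>x\<in>pverts G. f x) = 0" "(\<Sum>x\<in>pverts G. (f x)\<^sup>2) > 0" "0 \<le> R"
    and "(\<Sum>x\<in>pverts G. f x * (\<Sum>y\<in>pverts G. laplacian_entry G x y * f y)) \<le> R * (\<Sum>x\<in>pverts G. (f x)\<^sup>2)"
  shows "spectral_gap G \<le> R"
proof -
  obtain N q d i j where b: "symmetric_kernel_eigenbasis (pverts G) (laplacian_entry G) N q d"
    "i < N" "\<And>k. k < N \<Longrightarrow> k \<noteq> i \<Longrightarrow> d j \<le> d k" "spectral_gap G = d j"
    using spectral_gap_eigenvalue[OF assms(1-3)] by metis
  show ?thesis
    unfolding b(4) by (rule symmetric_kernel_eigenbasis.second_eigenvalue_le[OF b(1-3) assms(4-8)])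
qed

definition stack_label :: "nat \<Rightarrow> colored_perm \<Rightarrow> nat" where
  "stack_label j x = inv' (snd x) j"

definition stack_color :: "nat \<Rightarrow> colored_perm \<Rightarrow> int" where
  "stack_color j x = fst x j"

text \<open>
  Left multiplication by a generator. All values of \<open>\<epsilon>\<close> are allowed because the plain reversal of
  the stack, \<open>\<epsilon> = 0\<close>, is a symmetry needed for the upper bound.
\<close>

definition flip :: "nat \<Rightarrow> nat \<Rightarrow> int \<Rightarrow> nat \<Rightarrow> colored_perm \<Rightarrow> colored_perm" where
  "flip m n \<epsilon> i x = (prefix_color m n \<epsilon> i, prefix_rev i) \<otimes>\<^bsub>colored_perm_group m n\<^esub> x"

lemma prefix_rev_involution: "prefix_rev i (prefix_rev i j) = j"
  by (auto simp: prefix_rev_def)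

lemma prefix_rev_le_iff: "j \<ge> 1 \<Longrightarrow> prefix_rev i j \<le> i \<longleftrightarrow> j \<le> i"
  by (auto simp: prefix_rev_def)

lemma prefix_rev_permutes: "i \<le> n \<Longrightarrow> prefix_rev i permutes {1..n}"
  unfolding permutes_def by (metis (no_types, opaque_lifting) atLeastAtMost_iff order_trans prefix_rev_def prefix_rev_involution)

lemma inv_prefix_rev: "inv' (prefix_rev i) = prefix_rev i"
  by (rule inv_unique_comp) (auto simp: prefix_rev_involution)

lemma prefix_rev_closed: "i \<le> n \<Longrightarrow> j \<in> {1..n} \<Longrightarrow> prefix_rev i j \<in> {1..n}"
  by (auto simp: prefix_rev_def)

context
  fixes m n :: nat
  assumes m2: "m \<ge> 2" and n2: "n \<ge> 2"
begin

abbreviation "V \<equiv> carrier (colored_perm_group m n)"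

lemma V_iff: "x \<in> V \<longleftrightarrow> fst x \<in> (\<Pi>\<^sub>E i\<in>{1..n}. {0..<int m}) \<and> snd x permutes {1..n}"
  using m2 by (cases x) (simp add: colored_perm_group_def color_group_def sym_group_def carrier_integer_mod_group)

lemma finite_V: "finite V"
proof -
  have "V = (\<Pi>\<^sub>E i\<in>{1..n}. {0..<int m}) \<times> {p. p permutes {1..n}}"
    by (rule Set.set_eqI) (simp only: mem_Times_iff mem_Collect_eq V_iff)
  then show ?thesis by (simp add: finite_PiE finite_permutations)
qed

lemma flip_eq: "flip m n \<epsilon> i x = ((\<lambda>j\<in>{1..n}. ((if j \<le> i then \<epsilon> mod int m else 0) + fst x (prefix_rev i j)) mod int m),
    prefix_rev i \<circ> snd x)"
  by (cases x) (auto simp: flip_def colored_perm_group_def color_group_def sym_group_def perm_act_def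
      prefix_color_def inv_prefix_rev fun_eq_iff)

lemma flip_in_V:
  assumes "i \<in> {1..n}" "x \<in> V"
  shows "flip m n \<epsilon> i x \<in> V"
proof -
  have "prefix_rev i \<circ> snd x permutes {1..n}"
    using assms by (intro permutes_compose prefix_rev_permutes) (auto simp: V_iff)
  then show ?thesis using m2 by (auto simp: V_iff flip_eq)
qed

lemma stack_label_flip:
  assumes "i \<in> {1..n}" "x \<in> V"
  shows "stack_label j (flip m n \<epsilon> i x) = stack_label (prefix_rev i j) x"
proof -
  have "bij (prefix_rev i)" "bij (snd x)"
    using assms permutes_bij prefix_rev_permutes[of i n] by (auto simp: V_iff)
  then show ?thesis by (simp add: stack_label_def flip_eq o_inv_distrib inv_prefix_rev)
qed

lemma stack_color_flip:
  assumes "j \<in> {1..n}"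
  shows "stack_color j (flip m n \<epsilon> i x) = (stack_color (prefix_rev i j) x + (if j \<le> i then \<epsilon> else 0)) mod int m"
  using assms by (simp add: stack_color_def flip_eq mod_add_left_eq add.commute)

lemma stack_color_range: "x \<in> V \<Longrightarrow> j \<in> {1..n} \<Longrightarrow> stack_color j x \<in> {0..<int m}"
  by (auto simp: V_iff stack_color_def PiE_iff)

lemma stack_ext:
  assumes x: "x \<in> V" and y: "y \<in> V"
    and eq: "\<And>j. j \<in> {1..n} \<Longrightarrow> stack_label j x = stack_label j y \<and> stack_color j x = stack_color j y"
  shows "x = y"
proof -
  have p: "snd x permutes {1..n}" "snd y permutes {1..n}" using x y by (auto simp: V_iff)
  have "fst x = fst y"
    using x y eq by (intro PiE_ext[of _ "{1..n}" "\<lambda>_. {0..<int m}"]) (auto simp: V_iff stack_color_def)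
  moreover have "inv' (snd x) = inv' (snd y)"
  proof
    fix j show "inv' (snd x) j = inv' (snd y) j"
      using eq[of j] permutes_not_in[OF permutes_inv[OF p(1)], of j] permutes_not_in[OF permutes_inv[OF p(2)], of j]
      by (cases "j \<in> {1..n}") (simp_all add: stack_label_def)
  qed
  then have "snd x = snd y" using p by (metis permutes_inv_inv)
  ultimately show ?thesis by (simp add: prod_eq_iff)
qed

lemma flip_flip:
  assumes i: "i \<in> {1..n}" and x: "x \<in> V"
  shows "flip m n (- \<epsilon>) i (flip m n \<epsilon> i x) = x"
proof (rule stack_ext[OF flip_in_V[OF i flip_in_V[OF i x]] x])
  fix j assume j: "j \<in> {1..n}"
  have "prefix_rev i j \<in> {1..n}" using i j by (intro prefix_rev_closed) auto
  then have "stack_color j (flip m n (- \<epsilon>) i (flip m n \<epsilon> i x)) = stack_color j x mod int m"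
    using j by (simp add: stack_color_flip prefix_rev_involution prefix_rev_le_iff mod_simps)
  then show "stack_label j (flip m n (- \<epsilon>) i (flip m n \<epsilon> i x)) = stack_label j x \<and>
      stack_color j (flip m n (- \<epsilon>) i (flip m n \<epsilon> i x)) = stack_color j x"
    using stack_color_range[OF x j] flip_in_V[OF i x] i x
    by (simp add: stack_label_flip prefix_rev_involution)
qed

interpretation stacks: colored_stacks V n m stack_label stack_color "flip m n"
proof
  show "bij_betw (\<lambda>j. stack_label j x) {1..n} {1..n}" if "x \<in> V" for x
    using that permutes_imp_bij[OF permutes_inv] by (auto simp: V_iff stack_label_def)
  show "x = y" if "x \<in> V" "y \<in> V"
    "\<And>j. j \<in> {1..n} \<Longrightarrow> stack_label j x = stack_label j y \<and> stack_color j x = stack_color j y" for x y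
    using that by (rule stack_ext)
qed (use m2 finite_V flip_in_V flip_flip stack_label_flip stack_color_flip stack_color_range in auto)

text \<open>
  Index set of the generators without repetition: for \<open>m = 2\<close> the two signs give the same one.
\<close>

definition flips :: "(int \<times> nat) set" where
  "flips = (if m = 2 then {1} else {1, -1}) \<times> {1..n}"

lemma card_flips: "card flips = (if m = 2 then n else 2 * n)"
  by (simp add: flips_def card_cartesian_product)

lemma inj_on_flips:
  assumes x: "x \<in> V"
  shows "inj_on (\<lambda>(\<epsilon>, i). flip m n \<epsilon> i x) flips"
proof (rule inj_onI, clarify)
  fix \<epsilon> i \<epsilon>' i'
  assume e: "(\<epsilon>, i) \<in> flips" "(\<epsilon>', i') \<in> flips" and eq: "flip m n \<epsilon> i x = flip m n \<epsilon>' i' x"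
  then have i: "i \<in> {1..n}" "i' \<in> {1..n}" by (auto simp: flips_def)
  have "stack_label 1 (flip m n \<epsilon> i x) = stack_label i x" "stack_label 1 (flip m n \<epsilon>' i' x) = stack_label i' x"
    using stack_label_flip[OF i(1) x] stack_label_flip[OF i(2) x] i by (simp_all add: prefix_rev_def)
  then have "stack_label i x = stack_label i' x" using eq by simp
  then have ii: "i = i'" using stacks.lab_bij[OF x] i unfolding bij_betw_def inj_on_def by blast
  have "stack_color 1 (flip m n \<epsilon> i x) = stack_color 1 (flip m n \<epsilon>' i' x)" using eq by simp
  then have "(stack_color i x + \<epsilon>) mod int m = (stack_color i x + \<epsilon>') mod int m"
    using i n2 ii by (simp add: stack_color_flip prefix_rev_def)
  then have "int m dvd \<epsilon> - \<epsilon>'" by (simp add: mod_eq_dvd_iff)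
  moreover have "\<not> int m dvd 2" "\<not> int m dvd -2" if "m \<noteq> 2"
    using that m2 zdvd_imp_le[of "int m" 2] by auto
  ultimately have "\<epsilon> = \<epsilon>'" using e by (auto simp: flips_def split: if_splits)
  with ii show "\<epsilon> = \<epsilon>' \<and> i = i'" by simp
qed

lemma flip_neg_2: "m = 2 \<Longrightarrow> flip m n (-1) i x = flip m n 1 i x"
proof -
  assume "m = 2"
  then have "(- 1) mod int m = 1 mod int m" by simp
  then show ?thesis by (simp only: flip_eq)
qed

lemma pancake_arcs: "(x, y) \<in> parcs (pancake_graph m n) \<longleftrightarrow> x \<in> V \<and> y \<in> (\<lambda>(\<epsilon>, i). flip m n \<epsilon> i x) ` flips"
proof -
  have "(x, y) \<in> parcs (pancake_graph m n) \<longleftrightarrow> x \<in> V \<and> (\<exists>\<epsilon>\<in>{1, -1}. \<exists>i\<in>{1..n}. y = flip m n \<epsilon> i x)"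
  proof -
    have "(x, y) \<in> parcs (pancake_graph m n) \<longleftrightarrow>
        x \<in> V \<and> (\<exists>g\<in>gen_prefix_reversals m n. y = g \<otimes>\<^bsub>colored_perm_group m n\<^esub> x)"
      unfolding pancake_graph_def cayley_graph_def by (auto simp del: split_paired_Ex)
    also have "(\<exists>g\<in>gen_prefix_reversals m n. y = g \<otimes>\<^bsub>colored_perm_group m n\<^esub> x) \<longleftrightarrow>
        (\<exists>\<epsilon>\<in>{1, -1}. \<exists>i\<in>{1..n}. y = flip m n \<epsilon> i x)"
      unfolding gen_prefix_reversals_def flip_def by blast
    finally show ?thesis .
  qed
  also have "(\<exists>\<epsilon>\<in>{1, -1}. \<exists>i\<in>{1..n}. y = flip m n \<epsilon> i x) \<longleftrightarrow> y \<in> (\<lambda>(\<epsilon>, i). flip m n \<epsilon> i x) ` flips"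
    using flip_neg_2 by (auto simp: flips_def image_iff)
  finally show ?thesis .
qed

lemma pverts_pancake: "pverts (pancake_graph m n) = V"
  by (simp add: pancake_graph_def cayley_graph_def)

lemma exists_vertex: "(\<lambda>j\<in>{1..n}. 0, id) \<in> V"
  using m2 by (simp add: V_iff permutes_id)

lemma regular_degree_pancake: "regular_degree (pancake_graph m n) = card flips"
proof -
  have deg: "out_degree (with_proj (pancake_graph m n)) x = card flips" if x: "x \<in> V" for x
  proof -
    have "out_arcs (with_proj (pancake_graph m n)) x = Pair x ` (\<lambda>(\<epsilon>, i). flip m n \<epsilon> i x) ` flips"
      using x by (auto simp: pancake_arcs out_arcs_def)
    then show ?thesis
      using card_image[OF inj_on_flips[OF x]] by (simp add: out_degree_def card_image inj_on_def)
  qed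
  then show ?thesis
    unfolding regular_degree_def pverts_pancake using exists_vertex by (intro the_equality) auto
qed

lemma card_V: "card V \<ge> 2"
proof -
  let ?x = "(\<lambda>j\<in>{1..n}. 0, id) :: colored_perm"
  have "(\<lambda>(\<epsilon>, i). flip m n \<epsilon> i ?x) ` flips \<subseteq> V"
    using flip_in_V[OF _ exists_vertex] by (auto simp: flips_def)
  \<comment> \<open>The neighbors of a single vertex already number at least two.\<close>
  then have "card flips \<le> card V"
    using card_image[OF inj_on_flips[OF exists_vertex]] card_mono[OF finite_V] by metis
  then show ?thesis using n2 by (simp add: card_flips split: if_splits)
qed

text \<open>
  Averaging over the distinct generators is the same as averaging over all pairs of a sign and a
  length, also for \<open>m = 2\<close>, where every generator then occurs twice.
\<close>

lemma laplacian_entry_apply: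
  assumes x: "x \<in> V"
  shows "(\<Sum>y\<in>V. laplacian_entry (pancake_graph m n) x y * f y) = stacks.partial_laplacian n f x / real n"
proof -
  let ?N = "(\<lambda>(\<epsilon>, i). flip m n \<epsilon> i x) ` flips"
  have N: "?N \<subseteq> V" using flip_in_V[OF _ x] by (auto simp: flips_def)
  have "(\<Sum>y\<in>V. laplacian_entry (pancake_graph m n) x y * f y) =
      (\<Sum>y\<in>V. (if y = x then f y else 0) - (if y \<in> ?N then f y else 0) / real (card flips))"
    using x by (intro sum.cong refl) (simp add: laplacian_entry_def pancake_arcs regular_degree_pancake left_diff_distrib)
  also have "\<dots> = f x - (\<Sum>y\<in>?N. f y) / real (card flips)"
    using x finite_V N by (simp add: sum_subtractf sum.If_cases Int_absorb1 flip: sum_divide_distrib)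
  also have "(\<Sum>y\<in>?N. f y) = (\<Sum>(\<epsilon>, i)\<in>flips. f (flip m n \<epsilon> i x))"
    by (subst sum.reindex[OF inj_on_flips[OF x]]) (simp add: case_prod_unfold comp_def)
  also have "\<dots> / real (card flips) = (\<Sum>i\<in>{1..n}. (f (flip m n 1 i x) + f (flip m n (-1) i x)) / 2) / real n"
  proof (cases "m = 2")
    case True
    have "flips = {1} \<times> {1..n}" unfolding flips_def by (simp only: True refl if_True)
    then show ?thesis
      by (simp add: card_cartesian_product flip_neg_2[OF True] flip: sum.cartesian_product)
  next
    case False
    then show ?thesis
      by (simp add: flips_def card_cartesian_product sum.distrib flip: sum.cartesian_product sum_divide_distrib)
  qed
  also have "f x - \<dots> = stacks.partial_laplacian n f x / real n"
    using n2 by (simp add: stacks.partial_laplacian_def stacks.flip_laplacian_def sum_subtractf diff_divide_distrib)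
  finally show ?thesis .
qed

text \<open>
  Symmetry is read off from the kernel of the sum of the flip Laplacians, which acts in the same
  way on indicator functions of single vertices.
\<close>

lemma laplacian_entry_sym:
  assumes x: "x \<in> V" and y: "y \<in> V"
  shows "laplacian_entry (pancake_graph m n) x y = laplacian_entry (pancake_graph m n) y x"
proof -
  have *: "laplacian_entry (pancake_graph m n) x y = stacks.laplacian_kernel n x y / real n"
    if "x \<in> V" "y \<in> V" for x y
  proof -
    have pick: "(\<Sum>z\<in>V. k z * of_bool (z = y)) = k y" for k :: "colored_perm \<Rightarrow> real"
      using that finite_V by (simp add: of_bool_def if_distrib[of "\<lambda>a. _ * a"] cong: if_cong)
    show ?thesis
      using laplacian_entry_apply[OF that(1), of "\<lambda>z. of_bool (z = y)"]
        stacks.laplacian_kernel_apply[OF order_refl that(1), of "\<lambda>z. of_bool (z = y)"]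
      by (simp add: pick)
  qed
  show ?thesis using *[OF x y] *[OF y x] stacks.laplacian_kernel_sym[OF order_refl x y] by simp
qed

lemma pancake_gap_lower: "2 / (real n * (real m)\<^sup>2) \<le> spectral_gap (pancake_graph m n)"
proof (rule spectral_gap_ge; unfold pverts_pancake)
  fix f :: "colored_perm \<Rightarrow> real"
  assume "(\<Sum>x\<in>V. f x) = 0"
  then have "2 / (real m)\<^sup>2 * (\<Sum>x\<in>V. (f x)\<^sup>2) \<le> (\<Sum>x\<in>V. f x * stacks.partial_laplacian n f x)"
    by (intro stacks.block_gap) (simp_all add: stacks.block_all)
  then have "2 / (real m)\<^sup>2 * (\<Sum>x\<in>V. (f x)\<^sup>2) / real n \<le> (\<Sum>x\<in>V. f x * stacks.partial_laplacian n f x) / real n"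
    by (rule divide_right_mono) simp
  also have "\<dots> = (\<Sum>x\<in>V. f x * (\<Sum>y\<in>V. laplacian_entry (pancake_graph m n) x y * f y))"
    by (simp add: laplacian_entry_apply sum_divide_distrib)
  finally show "2 / (real n * (real m)\<^sup>2) * (\<Sum>x\<in>V. (f x)\<^sup>2) \<le>
      (\<Sum>x\<in>V. f x * (\<Sum>y\<in>V. laplacian_entry (pancake_graph m n) x y * f y))"
    by (simp add: mult.commute)
qed (use finite_V card_V laplacian_entry_sym in auto)

definition first_pos :: "colored_perm \<Rightarrow> nat" where
  "first_pos x = snd x 1"

text \<open>
  The real part of the character \<open>c \<mapsto> exp (2 \<pi> \<i> c / m)\<close>, evaluated at the color of the pancake
  with label \<open>1\<close>.
\<close>

definition first_wave :: "colored_perm \<Rightarrow> real" where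
  "first_wave x = cos (2 * pi * real_of_int (stack_color (first_pos x) x) / real m)"

lemma first_pos_range: "x \<in> V \<Longrightarrow> first_pos x \<in> {1..n}"
  using permutes_in_image[of "snd x" "{1..n}" 1] n2 by (simp add: V_iff first_pos_def)

lemma first_pos_flip: "first_pos (flip m n \<epsilon> i x) = prefix_rev i (first_pos x)"
  by (simp add: first_pos_def flip_eq)

lemma first_wave_flip:
  assumes i: "i \<in> {1..n}" and x: "x \<in> V"
  shows "first_wave (flip m n \<epsilon> i x) = cos (2 * pi * real_of_int (stack_color (first_pos x) x) / real m
    + (if first_pos x \<le> i then 2 * pi * real_of_int \<epsilon> / real m else 0))"
proof -
  have cos_mod: "cos (2 * pi * real_of_int (z mod int m) / real m) = cos (2 * pi * real_of_int z / real m)" for z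
  proof -
    have "real_of_int z = real_of_int (z mod int m) + real m * real_of_int (z div int m)"
      by (metis mod_mult_div_eq of_int_add of_int_mult of_int_of_nat_eq)
    then have "2 * pi * real_of_int z / real m =
        2 * pi * real_of_int (z mod int m) / real m + 2 * pi * real_of_int (z div int m)"
      using m2 by (simp add: field_simps)
    then show ?thesis by (simp add: cos_add cos_int_2pin sin_int_2pin)
  qed
  have p: "first_pos x \<in> {1..n}" using first_pos_range[OF x] .
  have "prefix_rev i (first_pos x) \<in> {1..n}" using i p by (intro prefix_rev_closed) auto
  then have "stack_color (first_pos (flip m n \<epsilon> i x)) (flip m n \<epsilon> i x) =
      (stack_color (first_pos x) x + (if first_pos x \<le> i then \<epsilon> else 0)) mod int m"
    using p by (simp add: first_pos_flip stack_color_flip prefix_rev_involution prefix_rev_le_iff)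
  then show ?thesis
    unfolding first_wave_def by (simp add: cos_mod distrib_left add_divide_distrib)
qed

text \<open>
  A flip of length \<open>i \<ge> first_pos x\<close> shifts the phase by \<open>\<plusminus> 2 \<pi> / m\<close>, and the average of the two
  shifts multiplies the cosine by \<open>cos (2 \<pi> / m)\<close>. There are \<open>n + 1 - first_pos x\<close> such lengths.
\<close>

lemma partial_laplacian_first_wave:
  assumes x: "x \<in> V"
  shows "stacks.partial_laplacian n first_wave x =
    (1 - cos (2 * pi / real m)) * ((real n + 1 - real (first_pos x)) * first_wave x)"
proof -
  define \<theta> where "\<theta> = 2 * pi * real_of_int (stack_color (first_pos x) x) / real m"
  have fx: "first_wave x = cos \<theta>" by (simp add: first_wave_def \<theta>_def)
  have "stacks.flip_laplacian i first_wave x =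
      (if first_pos x \<le> i then (1 - cos (2 * pi / real m)) * first_wave x else 0)" if "i \<in> {1..n}" for i
  proof -
    have "first_wave (flip m n 1 i x) = cos (\<theta> + (if first_pos x \<le> i then 2 * pi / real m else 0))"
      "first_wave (flip m n (-1) i x) = cos (\<theta> - (if first_pos x \<le> i then 2 * pi / real m else 0))"
      using first_wave_flip[OF that x] by (simp_all add: \<theta>_def)
    then show ?thesis by (simp add: stacks.flip_laplacian_def fx cos_add cos_diff left_diff_distrib right_diff_distrib mult.commute)
  qed
  then have "stacks.partial_laplacian n first_wave x =
      (\<Sum>i\<in>{1..n}. if first_pos x \<le> i then (1 - cos (2 * pi / real m)) * first_wave x else 0)"
    unfolding stacks.partial_laplacian_def by (rule sum.cong[OF refl])
  also have "\<dots> = (\<Sum>i\<in>{first_pos x..n}. (1 - cos (2 * pi / real m)) * first_wave x)"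
    using first_pos_range[OF x] by (intro sum.mono_neutral_cong_right) auto
  also have "\<dots> = (real n + 1 - real (first_pos x)) * ((1 - cos (2 * pi / real m)) * first_wave x)"
    using first_pos_range[OF x] by (simp add: of_nat_diff Suc_diff_le)
  finally show ?thesis by simp
qed

text \<open>
  Reversing the whole stack without recoloring maps position \<open>j\<close> to \<open>n + 1 - j\<close> and leaves the wave
  unchanged, so on average the position can be replaced by \<open>(n + 1) / 2\<close>.
\<close>

lemma sum_reversed_position:
  fixes g :: "real \<Rightarrow> real"
  shows "(\<Sum>x\<in>V. (real n + 1 - real (first_pos x)) * g (first_wave x)) =
    (real n + 1) / 2 * (\<Sum>x\<in>V. g (first_wave x))"
proof -
  have n: "n \<in> {1..n}" using n2 by simp
  have inv: "flip m n 0 n (flip m n 0 n x) = x" if "x \<in> V" for x using flip_flip[OF n that, of 0] by simp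
  have wave: "first_wave (flip m n 0 n x) = first_wave x" if "x \<in> V" for x
    using first_wave_flip[OF n that, of 0] by (simp add: first_wave_def)
  have pos: "real (first_pos (flip m n 0 n x)) = real n + 1 - real (first_pos x)" if "x \<in> V" for x
    using first_pos_range[OF that] by (simp add: first_pos_flip prefix_rev_def of_nat_diff)
  have "(\<Sum>x\<in>V. (real n + 1 - real (first_pos x)) * g (first_wave x)) =
      (\<Sum>x\<in>V. real (first_pos x) * g (first_wave x))"
    by (rule sum.reindex_bij_witness[where i = "flip m n 0 n" and j = "flip m n 0 n"])
      (use inv wave pos flip_in_V[OF n] in auto)
  moreover have "(\<Sum>x\<in>V. (real n + 1 - real (first_pos x)) * g (first_wave x)) +
      (\<Sum>x\<in>V. real (first_pos x) * g (first_wave x)) = (real n + 1) * (\<Sum>x\<in>V. g (first_wave x))"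
    unfolding sum.distrib[symmetric] sum_distrib_left by (intro sum.cong refl) (simp add: algebra_simps)
  ultimately show ?thesis by simp
qed

lemma pancake_gap_upper:
  "spectral_gap (pancake_graph m n) \<le> pi\<^sup>2 * (real n + 1) / (real n * (real m)\<^sup>2)"
proof (rule spectral_gap_le[where f = first_wave]; (unfold pverts_pancake)?)
  let ?d = "2 * pi / real m"
  have "0 < ?d" "?d \<le> pi" using m2 by (simp_all add: field_simps)
  then have cos_less: "cos ?d < 1" using cos_monotone_0_pi[of 0 ?d] by simp
  have cos_bound: "1 - cos ?d \<le> 2 * pi\<^sup>2 / (real m)\<^sup>2"
  proof -
    have "1 - cos ?d = 2 * (sin (pi / real m))\<^sup>2" using cos_double_sin[of "pi / real m"] by simp
    also have "(sin (pi / real m))\<^sup>2 \<le> (pi / real m)\<^sup>2"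
      using abs_sin_x_le_abs_x[of "pi / real m"] by (simp only: abs_le_square_iff)
    finally show ?thesis by (simp add: power_divide)
  qed
  show "(\<Sum>x\<in>V. first_wave x) = 0"
  proof -
    \<comment> \<open>The image of a Laplacian sums to zero. By the reversal symmetry its factor on the wave may be replaced by the mean \<open>(1 - cos ?d) (n + 1) / 2\<close>, which is nonzero.\<close>
    have "0 = (\<Sum>x\<in>V. stacks.partial_laplacian n first_wave x)"
      using stacks.sum_block_partial_laplacian[where p = n and f = first_wave] by (simp add: stacks.block_all)
    also have "\<dots> = (1 - cos ?d) * (\<Sum>x\<in>V. (real n + 1 - real (first_pos x)) * first_wave x)"
      by (simp add: partial_laplacian_first_wave sum_distrib_left)
    also have "\<dots> = (1 - cos ?d) * ((real n + 1) / 2 * (\<Sum>x\<in>V. first_wave x))"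
      using sum_reversed_position[of "\<lambda>t. t"] by simp
    finally show ?thesis using cos_less by simp
  qed
  show "(\<Sum>x\<in>V. (first_wave x)\<^sup>2) > 0"
    by (rule sum_pos2[OF finite_V exists_vertex]) (use n2 in \<open>simp_all add: first_wave_def first_pos_def stack_color_def\<close>)
  show "(\<Sum>x\<in>V. first_wave x * (\<Sum>y\<in>V. laplacian_entry (pancake_graph m n) x y * first_wave y)) \<le>
      pi\<^sup>2 * (real n + 1) / (real n * (real m)\<^sup>2) * (\<Sum>x\<in>V. (first_wave x)\<^sup>2)"
  proof -
    have "(\<Sum>x\<in>V. first_wave x * (\<Sum>y\<in>V. laplacian_entry (pancake_graph m n) x y * first_wave y)) =
        (\<Sum>x\<in>V. (1 - cos ?d) / real n * ((real n + 1 - real (first_pos x)) * (first_wave x)\<^sup>2))"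
      by (intro sum.cong refl) (simp add: laplacian_entry_apply partial_laplacian_first_wave power2_eq_square)
    also have "\<dots> = (1 - cos ?d) * ((real n + 1) / (2 * real n) * (\<Sum>x\<in>V. (first_wave x)\<^sup>2))"
      unfolding sum_distrib_left[symmetric] sum_reversed_position[of "\<lambda>t. t\<^sup>2"] by simp
    also have "\<dots> \<le> 2 * pi\<^sup>2 / (real m)\<^sup>2 * ((real n + 1) / (2 * real n) * (\<Sum>x\<in>V. (first_wave x)\<^sup>2))"
      using cos_bound by (intro mult_right_mono mult_nonneg_nonneg sum_nonneg) auto
    also have "\<dots> = pi\<^sup>2 * (real n + 1) / (real n * (real m)\<^sup>2) * (\<Sum>x\<in>V. (first_wave x)\<^sup>2)"
      by (simp add: mult_ac)
    finally show ?thesis .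
  qed
  show "(\<Sum>y\<in>V. laplacian_entry (pancake_graph m n) x y) = 0" if "x \<in> V" for x
    using laplacian_entry_apply[OF that, of "\<lambda>_. 1"]
    by (simp add: stacks.partial_laplacian_def stacks.flip_laplacian_def)
qed (use finite_V card_V laplacian_entry_sym in auto)

end

theorem corollary4p5:
  fixes m n :: nat
  assumes "n \<ge> 2" and "m \<ge> 2"
  shows "2 / (real n * (real m)\<^sup>2) \<le> spectral_gap (pancake_graph m n)
    \<and> spectral_gap (pancake_graph m n) \<le> pi\<^sup>2 * (real n + 1) / (real n * (real m)\<^sup>2)"
  using pancake_gap_lower[OF assms(2,1)] pancake_gap_upper[OF assms(2,1)] by simp

end
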